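(* Let $T=\bigcup_{l=1}^{N+M}[a_l,b_l]$ be a time scale consisting of $N<\infty$ segments and $M<\infty$ isolated points, with $N>0$ or $M\ge 3$, and let $q\in C(T^{0^2})$ be real-valued. For $j\in\{0,1\}$ let $\{\lambda_{nj}\}_{n\ge1}$ be the eigenvalues, numbered in increasing order, of the boundary value problem $L_j(T)$: $$-y^{\Delta\Delta}(x)+q(x)y(\sigma(x))=\lambda y(\sigma(x)),\quad x\in T^{0^2},\qquad y^{\Delta^j}(a_1)=y(b_{N+M})=0 .$$ Put $\Theta_{NM}:=+\infty$ if $N>0$ and $\Theta_{NM}:=M-2$ if $N=0$. Then the eigenvalues alternate in the following way: $$\lambda_{n1}<\lambda_{n0}<\lambda_{n+1,1}\quad\text{for all } n\in\mathbb N \text{ with } 1\le n\le \Theta_{NM},$$ where one puts $\lambda_{M-1,1}:=+\infty$ if $\Theta_{NM}=M-2$ (i.e. if $N=0$).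
   Context: **Time scale.** $T=\bigcup_{l=1}^{N+M}[a_l,b_l]\subset\mathbb R$, where $a_{l-1}\le b_{l-1}<a_l\le b_l$ for $l=2,\dots,N+M$, and exactly $N$ indices $l$ satisfy $a_l<b_l$ (segments), while the other $M$ indices satisfy $a_l=b_l$ (isolated points). **Notions of time scale calculus.** For a closed set $T\subset\mathbb R$ of this kind: $\sigma(x):=\inf\{s\in T: s>x\}$ for $x\ne\max T$ and $\sigma(\max T):=\max T$; $\sigma_-(x):=\sup\{s\in T: s<x\}$ for $x\neq\min T$ and $\sigma_-(\min T):=\min T$. A point $x$ is left-isolated if $\sigma_-(x)<x$. $T^0:=T\setminus\{\max T\}$ if $\max T$ is left-isolated (with the same definition applied to any closed set in place of $T$), and $T^0:=T$ otherwise; $T^{0^2}:=(T^0)^0$. A function $f$ on $T$ is $\Delta$-differentiable at $t\in T^0$ with $\Delta$-derivative $f^\Delta(t)$ if for every $\varepsilon>0$ there is $\delta>0$ such that $|f(\sigma(t))-f(s)-f^\Delta(t)(\sigma(t)-s)|\le\varepsilon|\sigma(t)-s|$ for all $s\in(t-\delta,t+\delta)\cap T$. $f^{\Delta\Delta}:=(f^\Delta)^\Delta$ on $T^{0^2}$; $f^{\Delta^0}:=f$, $f^{\Delta^1}:=f^\Delta$. $C(B)$ is the class of functions continuous on $B\subseteq T$; $C^2(T)$ is the class of functions $f$ such that $f^{\Delta\Delta}$ exists on $T^{0^2}$ and $f^{\Delta\Delta}\in C(T^{0^2})$. **Solutions and eigenvalues.** A solution of the equation is a function $y\in C^2(T)$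 satisfying it on $T^{0^2}$. A number $\lambda$ is an eigenvalue of $L_j(T)$ if there is a non-zero solution satisfying the boundary conditions. It is known that the eigenvalues of $L_j(T)$ are real, that they are the (simple) zeros of an entire function of $\lambda$, that there are infinitely many of them if $N>0$ and exactly $M-2$ if $N=0$, and that they can be numbered increasingly: $\lambda_{nj}<\lambda_{n+1,j}$.
   Formalization: In C²(T), y^ΔΔ is only required to be rd-continuous (it may jump at right-scattered points), and σ in the equation is the jump operator of T⁰; read literally, e.g. T=[0,1]∪[2,3] with q=0, j=0 would have no eigenvalues. *)

theory Defs
  imports "HOL-Analysis.Analysis" "HOL-Library.Extended_Nat" "HOL-Library.Extended_Real"
begin

text \<open>
  A time scale is a nonempty compact set \<open>T\<close> of reals, so \<open>Sup T\<close> and \<open>Inf T\<close> are its maximum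
  and minimum.  Functions on \<open>T\<close> are total functions on the reals of which only the values on
  \<open>T\<close> matter.
\<close>

definition fjump :: "real set \<Rightarrow> real \<Rightarrow> real" where
  "fjump T x = (if x = Sup T then Sup T else Inf {s \<in> T. x < s})"

definition bjump :: "real set \<Rightarrow> real \<Rightarrow> real" where
  "bjump T x = (if x = Inf T then Inf T else Sup {s \<in> T. s < x})"

definition left_isolated :: "real set \<Rightarrow> real \<Rightarrow> bool" where
  "left_isolated T x \<longleftrightarrow> bjump T x < x"

definition trunc :: "real set \<Rightarrow> real set" where
  "trunc T = (if left_isolated T (Sup T) then T - {Sup T} else T)"

definition has_delta_derivative ::
    "real set \<Rightarrow> (real \<Rightarrow> 'a::real_normed_vector) \<Rightarrow> 'a \<Rightarrow> real \<Rightarrow> bool" where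
  "has_delta_derivative T f D t \<longleftrightarrow>
     t \<in> trunc T \<and>
     (\<forall>\<epsilon>>0. \<exists>\<delta>>0. \<forall>s \<in> {t - \<delta><..<t + \<delta>} \<inter> T.
        norm (f (fjump T t) - f s - (fjump T t - s) *\<^sub>R D) \<le> \<epsilon> * \<bar>fjump T t - s\<bar>)"

definition delta_differentiable :: "real set \<Rightarrow> (real \<Rightarrow> 'a::real_normed_vector) \<Rightarrow> real \<Rightarrow> bool" where
  "delta_differentiable T f t \<longleftrightarrow> (\<exists>D. has_delta_derivative T f D t)"

text \<open>The derivative is unique as soon as \<open>T\<close> has at least two points.\<close>

definition delta_deriv :: "real set \<Rightarrow> (real \<Rightarrow> 'a::real_normed_vector) \<Rightarrow> real \<Rightarrow> 'a" where
  "delta_deriv T f t = (THE D. has_delta_derivative T f D t)"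

text \<open>
  The first derivative is a function on the time scale \<open>trunc T\<close>, so every further derivative is
  taken there; \<open>delta_iter T n f\<close> is meaningful on \<open>(trunc ^^ n) T\<close>.
\<close>

primrec delta_iter :: "real set \<Rightarrow> nat \<Rightarrow> (real \<Rightarrow> 'a::real_normed_vector) \<Rightarrow> real \<Rightarrow> 'a" where
  "delta_iter T 0 f = f"
| "delta_iter T (Suc n) f = delta_iter (trunc T) n (delta_deriv T f)"

text \<open>
  Continuity on \<open>B\<close> in the sense of time scale calculus (rd-continuity), for \<open>B\<close> a subset of the
  time scale \<open>S\<close>: continuity is required except at right-scattered points of \<open>S\<close>, and the left limit
  must exist at left-dense points.
\<close>

definition rd_continuous_on :: "real set \<Rightarrow> real set \<Rightarrow> (real \<Rightarrow> 'a::real_normed_vector) \<Rightarrow> bool" where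
  "rd_continuous_on S B f \<longleftrightarrow>
     (\<forall>t\<in>B. (fjump S t = t \<longrightarrow> continuous (at t within B) f) \<and>
            (\<not> left_isolated S t \<longrightarrow> (\<exists>L. (f \<longlongrightarrow> L) (at t within (B \<inter> {..<t})))))"

text \<open>
  The second derivative of a solution equals \<open>(q x - \<mu>) y (\<sigma> x)\<close>, which jumps at the right end
  of a segment that is followed by further points.  Ordinary continuity of the second
  derivative there would exclude almost all solutions (for two segments and zero potential there
  would be no Dirichlet eigenvalue at all), hence rd-continuity, with respect to the time scale
  \<open>trunc T\<close> on which the second differentiation takes place.
\<close>

definition C2 :: "real set \<Rightarrow> (real \<Rightarrow> 'a::real_normed_vector) \<Rightarrow> bool" where
  "C2 T f \<longleftrightarrow>
     (\<forall>t \<in> trunc T. delta_differentiable T f t) \<and>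
     (\<forall>t \<in> trunc (trunc T). delta_differentiable (trunc T) (delta_deriv T f) t) \<and>
     rd_continuous_on (trunc T) (trunc (trunc T)) (delta_iter T 2 f)"

text \<open>
  The jump operator in the equation is that of \<open>trunc T\<close>, the time scale in which the second
  derivative is taken.  On \<open>trunc (trunc T)\<close> it agrees with the jump operator of \<open>T\<close>, with one
  exception: if \<open>T\<close> ends with a segment followed by a single isolated point, it fixes the right end
  \<open>b\<close> of that segment.  There the second derivative is the left derivative of the first one, hence
  equal to \<open>(q b - \<mu>) y b\<close>; with \<open>y (Sup T)\<close> in place of \<open>y b\<close> the equation would force
  \<open>y b = y (Sup T)\<close> or \<open>\<mu> = q b\<close>.
\<close>

definition is_solution :: "real set \<Rightarrow> (real \<Rightarrow> real) \<Rightarrow> complex \<Rightarrow> (real \<Rightarrow> complex) \<Rightarrow> bool" where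
  "is_solution T q \<mu> y \<longleftrightarrow>
     C2 T y \<and>
     (\<forall>x \<in> trunc (trunc T).
        - delta_iter T 2 y x + of_real (q x) * y (fjump (trunc T) x) = \<mu> * y (fjump (trunc T) x))"

definition eigenvalues :: "real set \<Rightarrow> (real \<Rightarrow> real) \<Rightarrow> nat \<Rightarrow> complex set" where
  "eigenvalues T q j =
     {\<mu>. \<exists>y. is_solution T q \<mu> y \<and> (\<exists>x\<in>T. y x \<noteq> 0) \<and>
             delta_iter T j y (Inf T) = 0 \<and> y (Sup T) = 0}"

definition Theta :: "nat \<Rightarrow> nat \<Rightarrow> enat" where
  "Theta N M = (if N > 0 then \<infinity> else enat (M - 2))"

definition increasing_numbering :: "enat \<Rightarrow> complex set \<Rightarrow> (nat \<Rightarrow> real) \<Rightarrow> bool" where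
  "increasing_numbering \<theta> E lam \<longleftrightarrow>
     strict_mono_on {n. 1 \<le> n \<and> enat n \<le> \<theta>} lam \<and>
     E = (\<lambda>n. complex_of_real (lam n)) ` {n. 1 \<le> n \<and> enat n \<le> \<theta>}"

end

theory Submission
  imports Defs
begin

text \<open>
  Let \<open>\<psi>\<close> be the solution running backward from the right end of the time scale with \<open>\<psi> = 0\<close> and
  \<open>\<psi>\<^sup>\<Delta> = -1\<close> there, and write \<open>(u \<mu>, v \<mu>)\<close> for its initial data \<open>(\<psi>, \<psi>\<^sup>\<Delta>)\<close> at the left end.  The
  Wronskian of a solution vanishing at the right end with \<open>\<psi>\<close> is constant, hence zero, so the real eigenvalues
  of the two problems are the zeros of \<open>u\<close> and of \<open>v\<close>.  The Wronskian of two solutions \<open>\<psi>\<close> for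
  different parameters \<open>\<mu>\<close>, \<open>\<nu>\<close> accumulates \<open>(\<nu> - \<mu>)\<close> times an inner product, so the planar curve
  \<open>(u, v)\<close> rotates strictly in one direction: \<open>v / u\<close> increases wherever \<open>u \<noteq> 0\<close>.  Hence the zeros
  of \<open>u\<close> and \<open>v\<close> separate each other.  As \<open>u v < 0\<close> for \<open>\<mu>\<close> near \<open>-\<infinity>\<close>, a zero of \<open>v\<close> lies
  below every zero of \<open>u\<close>, and counting gives the alternation.
\<close>

section \<open>Linear second-order equations depending on a parameter\<close>

text \<open>Both problems share the condition at the right end, so a single backward family serves
  both. The bracket \<open>u \<mu> * v \<nu> - v \<mu> * u \<nu>\<close> compares two parameters,
  and its explicit factor \<open>\<nu> - \<mu>\<close> yields a derivative at
  \<open>\<nu> = \<mu>\<close> from continuity alone; hence the Picard construction only has to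
  deliver continuity in the parameter. Two obstacles shape the rest. Near the right end the rotation
  may stall: the data start as the constant \<open>(0, -1)\<close>, and a gap of length
  \<open>h\<close> contributes \<open>h\<close> times the squared value at its right end, which is
  zero in front of an isolated maximum. So weak rotation is carried from block to block and
  strictness is recorded separately. Moreover, differentiation shortens the time scale: at an
  isolated maximum an eigenfunction has no derivative, so its Wronskian has to be anchored one block
  earlier. For isolated points only, separation of zeros alone would still allow a surplus zero of
  \<open>v\<close> above the last zero of \<open>u\<close>; the index set common to both numberings
  excludes it.\<close>

primrec picard :: "real \<Rightarrow> real \<Rightarrow> (real \<Rightarrow> real) \<Rightarrow> (real \<Rightarrow> real) \<Rightarrow> (real \<Rightarrow> real) \<Rightarrow>
    nat \<Rightarrow> real \<Rightarrow> real \<Rightarrow> real" where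
  "picard \<alpha> \<beta> q u v 0 \<mu> x = u \<mu> + v \<mu> * (x - \<beta>)"
| "picard \<alpha> \<beta> q u v (Suc n) \<mu> x =
     integral {\<alpha>..\<beta>} (\<lambda>t. max 0 (t - x) * ((q t - \<mu>) * picard \<alpha> \<beta> q u v n \<mu> t))"

lemma continuous_on_integral_param:
  fixes f :: "'a::topological_space \<Rightarrow> real \<Rightarrow> real"
  assumes "continuous_on (U \<times> {a..b}) (\<lambda>(x, t). f x t)"
  shows "continuous_on U (\<lambda>x. integral {a..b} (f x))"
  using integral_continuous_on_param[of U a b f] assms by simp

lemma continuous_on_slice:
  assumes "continuous_on (U \<times> S) (\<lambda>(\<mu>, x). f \<mu> x)" "\<mu> \<in> U"
  shows "continuous_on S (f \<mu>)"
  by (rule continuous_on_compose2[OF assms(1), of S "Pair \<mu>", simplified])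
    (use assms(2) in \<open>auto intro!: continuous_intros\<close>)

lemma picard_continuous:
  assumes q: "continuous_on {\<alpha>..\<beta>} q" and u: "continuous_on UNIV u" and v: "continuous_on UNIV v"
  shows "continuous_on (UNIV \<times> {\<alpha>..\<beta>}) (\<lambda>(\<mu>, x). picard \<alpha> \<beta> q u v n \<mu> x)"
proof (induction n)
  case 0
  show ?case
    by (auto simp: case_prod_unfold intro!: continuous_intros continuous_on_compose2[OF u]
        continuous_on_compose2[OF v])
next
  case (Suc n)
  have "continuous_on (UNIV \<times> {\<alpha>..\<beta>})
      (\<lambda>p. integral {\<alpha>..\<beta>} (\<lambda>t. max 0 (t - snd p) * ((q t - fst p) * picard \<alpha> \<beta> q u v n (fst p) t)))"
    by (rule continuous_on_integral_param)
      (auto simp: case_prod_unfold intro!: continuous_intros continuous_on_compose2[OF q]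
        continuous_on_compose2[OF Suc[unfolded case_prod_unfold], of _ "\<lambda>x. (fst (fst x), snd x)", simplified])
  then show ?case
    by (simp add: case_prod_unfold)
qed

lemma picard_bound:
  assumes ab: "\<alpha> \<le> \<beta>" and q: "continuous_on {\<alpha>..\<beta>} q"
    and u: "continuous_on UNIV u" and v: "continuous_on UNIV v"
  shows "\<exists>C\<ge>0. \<forall>n. \<forall>\<mu>\<in>{-R..R}. \<forall>x\<in>{\<alpha>..\<beta>}. \<bar>picard \<alpha> \<beta> q u v n \<mu> x\<bar> \<le> C * (1 / 2) ^ n"
proof -
  let ?K = "{-R..R} \<times> {\<alpha>..\<beta>}"
  have "compact ?K" by (intro compact_Times compact_Icc)
  moreover have "continuous_on ?K (\<lambda>(\<mu>, x). picard \<alpha> \<beta> q u v 0 \<mu> x)"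
    by (rule continuous_on_subset[OF picard_continuous[OF q u v]]) auto
  ultimately obtain A where A: "A > 0" "\<And>\<mu> x. \<mu> \<in> {-R..R} \<Longrightarrow> x \<in> {\<alpha>..\<beta>} \<Longrightarrow> \<bar>picard \<alpha> \<beta> q u v 0 \<mu> x\<bar> \<le> A"
    using compact_imp_bounded[OF compact_continuous_image, of ?K "\<lambda>(\<mu>, x). picard \<alpha> \<beta> q u v 0 \<mu> x"]
    unfolding bounded_pos by force
  obtain B where B: "B > 0" "\<And>t. t \<in> {\<alpha>..\<beta>} \<Longrightarrow> \<bar>q t\<bar> \<le> B"
    using compact_imp_bounded[OF compact_continuous_image[OF q compact_Icc]]
    unfolding bounded_pos by force
  define Q where "Q = B + \<bar>R\<bar>"
  \<comment> \<open>The summand 1 keeps \<open>k\<close> positive when the interval is a single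
    point.\<close>
  define k where "k = 2 * Q * (\<beta> - \<alpha>) + 1"
  have Q: "Q > 0" using B(1) by (simp add: Q_def)
  have k: "k > 0" using Q ab by (simp add: k_def add_nonneg_pos)
  \<comment> \<open>The kernel \<open>max 0 (t - x)\<close> is at most \<open>exp (k (t - x)) / k\<close>, so in the weighted norm
    \<open>sup \<bar>f x\<bar> exp (k (x - \<beta>))\<close> each step contracts by \<open>Q (\<beta> - \<alpha>) / k \<le> 1/2\<close>.\<close>
  have weighted: "\<bar>picard \<alpha> \<beta> q u v n \<mu> x\<bar> \<le> A * (1 / 2) ^ n * exp (k * (\<beta> - x))"
    if "\<mu> \<in> {-R..R}" "x \<in> {\<alpha>..\<beta>}" for n \<mu> x
    using that(2)
  proof (induction n arbitrary: x)
    case 0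
    have "1 \<le> exp (k * (\<beta> - x))" using 0 k by simp
    then have "A \<le> A * exp (k * (\<beta> - x))" using A(1) by simp
    then show ?case using A(2)[OF that(1) 0] by simp
  next
    case (Suc n)
    let ?f = "\<lambda>t. max 0 (t - x) * ((q t - \<mu>) * picard \<alpha> \<beta> q u v n \<mu> t)"
    let ?C = "Q * (A * (1 / 2) ^ n) * exp (k * (\<beta> - x)) / k"
    have bound: "\<bar>?f t\<bar> \<le> ?C" if t: "t \<in> {\<alpha>..\<beta>}" for t
    proof -
      have "k * (t - x) \<le> exp (k * (t - x))" using exp_ge_add_one_self[of "k * (t - x)"] by linarith
      then have "max 0 (t - x) \<le> exp (k * (t - x)) / k" using k by (auto simp: field_simps)
      moreover have "\<bar>q t - \<mu>\<bar> \<le> Q" using B(2)[OF t] \<open>\<mu> \<in> {-R..R}\<close> by (auto simp: Q_def)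
      ultimately have "\<bar>max 0 (t - x)\<bar> * (\<bar>q t - \<mu>\<bar> * \<bar>picard \<alpha> \<beta> q u v n \<mu> t\<bar>) \<le>
          exp (k * (t - x)) / k * (Q * (A * (1 / 2) ^ n * exp (k * (\<beta> - t))))"
        using Suc.IH[OF t] k Q A(1) by (intro mult_mono) auto
      also have "\<dots> = Q * (A * (1 / 2) ^ n) * (exp (k * (t - x)) * exp (k * (\<beta> - t))) / k"
        by (simp add: field_simps)
      also have "exp (k * (t - x)) * exp (k * (\<beta> - t)) = exp (k * (\<beta> - x))"
        by (simp add: exp_add[symmetric] algebra_simps)
      finally show ?thesis by (simp add: abs_mult)
    qed
    have "continuous_on {\<alpha>..\<beta>} (\<lambda>t. picard \<alpha> \<beta> q u v n \<mu> t)"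
      by (rule continuous_on_slice[OF picard_continuous[OF q u v]]) simp
    then have "continuous_on {\<alpha>..\<beta>} ?f" by (intro continuous_intros q)
    then have "?f integrable_on cbox \<alpha> \<beta>" by (simp add: integrable_continuous_real)
    then have "(?f has_integral integral {\<alpha>..\<beta>} ?f) (cbox \<alpha> \<beta>)" by (simp add: has_integral_iff)
    then have "norm (integral {\<alpha>..\<beta>} ?f) \<le> ?C * measure lborel (cbox \<alpha> \<beta>)"
      by (rule has_integral_bound[rotated]) (use bound k Q A(1) in auto)
    also have "\<dots> = (Q * (\<beta> - \<alpha>) / k) * (A * (1 / 2) ^ n * exp (k * (\<beta> - x)))"
      using ab by (simp add: field_simps)
    also have "\<dots> \<le> (1 / 2) * (A * (1 / 2) ^ n * exp (k * (\<beta> - x)))"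
      using A(1) k by (intro mult_right_mono) (auto simp: k_def field_simps)
    finally show ?case by simp
  qed
  show ?thesis
  proof (intro exI[of _ "A * exp (k * (\<beta> - \<alpha>))"] conjI allI ballI)
    show "0 \<le> A * exp (k * (\<beta> - \<alpha>))" using A(1) by simp
    fix n \<mu> x assume m: "\<mu> \<in> {-R..R}" and x: "x \<in> {\<alpha>..\<beta>}"
    have "exp (k * (\<beta> - x)) \<le> exp (k * (\<beta> - \<alpha>))" using x k by simp
    then have "A * (1 / 2) ^ n * exp (k * (\<beta> - x)) \<le> A * (1 / 2) ^ n * exp (k * (\<beta> - \<alpha>))"
      using A(1) by (intro mult_left_mono) auto
    with weighted[OF m x, of n] show "\<bar>picard \<alpha> \<beta> q u v n \<mu> x\<bar> \<le> A * exp (k * (\<beta> - \<alpha>)) * (1 / 2) ^ n"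
      by (simp add: mult_ac)
  qed
qed

text \<open>Neumann series: \<open>picard\<close> gives the terms, not the iterates, so the solution
  is their sum. The kernel \<open>max 0 (t - x)\<close> writes the double integral from
  \<open>x\<close> to \<open>\<beta>\<close> as an integral over a fixed interval, which makes
  continuity in \<open>(\<mu>, x)\<close> a matter of parameter integrals.\<close>

lemma integral_equation_solution:
  assumes ab: "\<alpha> \<le> \<beta>" and q: "continuous_on {\<alpha>..\<beta>} q"
    and u: "continuous_on UNIV u" and v: "continuous_on UNIV v"
  obtains Y :: "real \<Rightarrow> real \<Rightarrow> real" where
    "continuous_on (UNIV \<times> {\<alpha>..\<beta>}) (\<lambda>(\<mu>, x). Y \<mu> x)"
    "\<And>\<mu> x. x \<in> {\<alpha>..\<beta>} \<Longrightarrow> Y \<mu> x = u \<mu> + v \<mu> * (x - \<beta>) +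
       integral {\<alpha>..\<beta>} (\<lambda>t. max 0 (t - x) * ((q t - \<mu>) * Y \<mu> t))"
proof
  let ?p = "picard \<alpha> \<beta> q u v"
  define Y where "Y \<mu> x = (\<Sum>n. ?p n \<mu> x)" for \<mu> x
  \<comment> \<open>The geometric bound has a constant depending on \<open>R\<close>, so convergence
    is uniform for bounded \<open>\<mu>\<close> only; continuity, being local, can be assembled from
    these strips.\<close>
  have unif: "uniform_limit ({-R..R} \<times> {\<alpha>..\<beta>}) (\<lambda>n z. \<Sum>i<n. case z of (\<mu>, x) \<Rightarrow> ?p i \<mu> x)
      (\<lambda>z. \<Sum>i. case z of (\<mu>, x) \<Rightarrow> ?p i \<mu> x) sequentially" for R
  proof -
    obtain C where C: "C \<ge> 0" "\<And>n \<mu> x. \<mu> \<in> {-R..R} \<Longrightarrow> x \<in> {\<alpha>..\<beta>} \<Longrightarrow> \<bar>?p n \<mu> x\<bar> \<le> C * (1 / 2) ^ n"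
      using picard_bound[OF ab q u v, of R] by blast
    show ?thesis
      by (rule Weierstrass_m_test[where M = "\<lambda>n. C * (1 / 2) ^ n"])
        (use C in \<open>auto intro!: summable_mult summable_geometric\<close>)
  qed
  have cont: "continuous_on ({-R..R} \<times> {\<alpha>..\<beta>}) (\<lambda>(\<mu>, x). Y \<mu> x)" for R
  proof -
    have "continuous_on ({-R..R} \<times> {\<alpha>..\<beta>}) (\<lambda>z. \<Sum>i. case z of (\<mu>, x) \<Rightarrow> ?p i \<mu> x)"
    proof (rule uniform_limit_theorem[OF _ unif])
      have "continuous_on ({-R..R} \<times> {\<alpha>..\<beta>}) (\<lambda>z. case z of (\<mu>, x) \<Rightarrow> ?p i \<mu> x)" for i
        by (rule continuous_on_subset[OF picard_continuous[OF q u v]]) auto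
      then show "\<forall>\<^sub>F n in sequentially. continuous_on ({-R..R} \<times> {\<alpha>..\<beta>})
          (\<lambda>z. \<Sum>i<n. case z of (\<mu>, x) \<Rightarrow> ?p i \<mu> x)"
        by (intro always_eventually allI continuous_on_sum)
    qed simp
    then show ?thesis by (simp add: Y_def case_prod_unfold)
  qed
  show "continuous_on (UNIV \<times> {\<alpha>..\<beta>}) (\<lambda>(\<mu>, x). Y \<mu> x)"
    unfolding continuous_on_eq_continuous_within
  proof
    fix z :: "real \<times> real" assume z: "z \<in> UNIV \<times> {\<alpha>..\<beta>}"
    define R :: real where "R = \<bar>fst z\<bar> + 1"
    have "at z within UNIV \<times> {\<alpha>..\<beta>} = at z within {-R..R} \<times> {\<alpha>..\<beta>}"
      by (rule at_within_nhd[of _ "{-R<..<R} \<times> UNIV"]) (use z in \<open>auto simp: R_def open_Times mem_Times_iff\<close>)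
    moreover have "z \<in> {-R..R} \<times> {\<alpha>..\<beta>}" using z by (auto simp: R_def)
    ultimately show "continuous (at z within UNIV \<times> {\<alpha>..\<beta>}) (\<lambda>(\<mu>, x). Y \<mu> x)"
      using cont[of R] unfolding continuous_on_eq_continuous_within by metis
  qed
  fix \<mu> x assume x: "x \<in> {\<alpha>..\<beta>}"
  define R :: real where "R = \<bar>\<mu>\<bar>"
  have \<mu>: "\<mu> \<in> {-R..R}" by (auto simp: R_def)
  have lim: "uniform_limit {\<alpha>..\<beta>} (\<lambda>n t. \<Sum>i<n. ?p i \<mu> t) (\<lambda>t. Y \<mu> t) sequentially"
    using uniform_limit_on_subset[OF unif[of R], of "{\<mu>} \<times> {\<alpha>..\<beta>}"] \<mu>
    unfolding uniform_limit_iff Y_def by fastforce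
  let ?k = "\<lambda>t. max 0 (t - x) * (q t - \<mu>)"
  have pc: "continuous_on {\<alpha>..\<beta>} (\<lambda>t. ?p n \<mu> t)" for n
    by (rule continuous_on_slice[OF picard_continuous[OF q u v]]) simp
  have kc: "continuous_on {\<alpha>..\<beta>} ?k" by (intro continuous_intros q)
  have Yb: "bounded ((\<lambda>t. Y \<mu> t) ` {\<alpha>..\<beta>})"
    by (intro compact_imp_bounded compact_continuous_image continuous_on_slice[OF cont \<mu>] compact_Icc)
  have kb: "bounded (?k ` {\<alpha>..\<beta>})"
    by (intro compact_imp_bounded compact_continuous_image kc compact_Icc)
  \<comment> \<open>Multiplying by the bounded kernel preserves uniform convergence, so the limit
    may be taken under the integral sign.\<close>
  have ul: "uniform_limit {\<alpha>..\<beta>} (\<lambda>n t. ?k t * (\<Sum>i<n. ?p i \<mu> t)) (\<lambda>t. ?k t * Y \<mu> t) sequentially"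
    by (rule bounded_bilinear.bounded_uniform_limit[OF bounded_bilinear_mult uniform_limit_const lim Yb kb])
  have "continuous_on {\<alpha>..\<beta>} (\<lambda>t. ?k t * (\<Sum>i<n. ?p i \<mu> t))" for n
    by (intro continuous_on_mult[OF kc] continuous_on_sum pc)
  then obtain I J where IJ: "\<And>n. ((\<lambda>t. ?k t * (\<Sum>i<n. ?p i \<mu> t)) has_integral I n) {\<alpha>..\<beta>}"
     "((\<lambda>t. ?k t * Y \<mu> t) has_integral J) {\<alpha>..\<beta>}" "I \<longlonglongrightarrow> J"
    by (rule uniform_limit_integral[OF ul]) auto
  have I: "I n = (\<Sum>i<n. ?p (Suc i) \<mu> x)" for n
  proof -
    have "((\<lambda>t. max 0 (t - x) * ((q t - \<mu>) * ?p i \<mu> t)) has_integral ?p (Suc i) \<mu> x) {\<alpha>..\<beta>}" for i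
      unfolding picard.simps
      by (intro integrable_integral integrable_continuous_real continuous_intros q pc)
    then have "((\<lambda>t. \<Sum>i<n. max 0 (t - x) * ((q t - \<mu>) * ?p i \<mu> t)) has_integral (\<Sum>i<n. ?p (Suc i) \<mu> x)) {\<alpha>..\<beta>}"
      by (rule has_integral_sum[OF finite_lessThan])
    moreover have "(\<lambda>t. \<Sum>i<n. max 0 (t - x) * ((q t - \<mu>) * ?p i \<mu> t)) = (\<lambda>t. ?k t * (\<Sum>i<n. ?p i \<mu> t))"
      by (simp only: sum_distrib_left mult.assoc)
    ultimately have "((\<lambda>t. ?k t * (\<Sum>i<n. ?p i \<mu> t)) has_integral (\<Sum>i<n. ?p (Suc i) \<mu> x)) {\<alpha>..\<beta>}"
      by (simp only:)
    with IJ(1)[of n] show ?thesis by (rule has_integral_unique)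
  qed
  have "(\<lambda>n. \<Sum>i<n. ?p i \<mu> x) \<longlonglongrightarrow> Y \<mu> x"
    using tendsto_uniform_limitI[OF lim x] .
  then have "(\<lambda>n. \<Sum>i<Suc n. ?p i \<mu> x) \<longlonglongrightarrow> Y \<mu> x"
    by (rule LIMSEQ_Suc)
  then have "(\<lambda>n. ?p 0 \<mu> x + I n) \<longlonglongrightarrow> Y \<mu> x"
    unfolding I sum.lessThan_Suc_shift .
  moreover have "(\<lambda>n. ?p 0 \<mu> x + I n) \<longlonglongrightarrow> ?p 0 \<mu> x + J"
    by (intro tendsto_intros IJ)
  ultimately have "Y \<mu> x = ?p 0 \<mu> x + J"
    by (rule LIMSEQ_unique)
  then show "Y \<mu> x = u \<mu> + v \<mu> * (x - \<beta>) +
       integral {\<alpha>..\<beta>} (\<lambda>t. max 0 (t - x) * ((q t - \<mu>) * Y \<mu> t))"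
    using integral_unique[OF IJ(2)] by (simp add: mult.assoc)
qed

text \<open>The data at \<open>\<beta>\<close> are functions of \<open>\<mu>\<close> because they
  are handed over by the part of the time scale to the right.\<close>

lemma linear_ivp:
  assumes ab: "\<alpha> \<le> \<beta>" and q: "continuous_on {\<alpha>..\<beta>} q"
    and u: "continuous_on UNIV u" and v: "continuous_on UNIV v"
  obtains Y Y1 :: "real \<Rightarrow> real \<Rightarrow> real" where
    "\<And>\<mu>. Y \<mu> \<beta> = u \<mu>" "\<And>\<mu>. Y1 \<mu> \<beta> = v \<mu>"
    "\<And>\<mu> x. x \<in> {\<alpha>..\<beta>} \<Longrightarrow> (Y \<mu> has_real_derivative Y1 \<mu> x) (at x within {\<alpha>..\<beta>})"
    "\<And>\<mu> x. x \<in> {\<alpha>..\<beta>} \<Longrightarrow> (Y1 \<mu> has_real_derivative (q x - \<mu>) * Y \<mu> x) (at x within {\<alpha>..\<beta>})"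
    "continuous_on (UNIV \<times> {\<alpha>..\<beta>}) (\<lambda>(\<mu>, x). Y \<mu> x)"
    "continuous_on UNIV (\<lambda>\<mu>. Y1 \<mu> \<alpha>)"
proof -
  obtain Y where Yc: "continuous_on (UNIV \<times> {\<alpha>..\<beta>}) (\<lambda>(\<mu>, x). Y \<mu> x)" and
    Y: "\<And>\<mu> x. x \<in> {\<alpha>..\<beta>} \<Longrightarrow> Y \<mu> x = u \<mu> + v \<mu> * (x - \<beta>) +
       integral {\<alpha>..\<beta>} (\<lambda>t. max 0 (t - x) * ((q t - \<mu>) * Y \<mu> t))"
    using integral_equation_solution[OF ab q u v] by blast
  define h where "h \<mu> t = (q t - \<mu>) * Y \<mu> t" for \<mu> t
  define Y1 where "Y1 \<mu> x = v \<mu> - integral {x..\<beta>} (h \<mu>)" for \<mu> x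
  have Yc2: "continuous_on ((UNIV :: real set) \<times> {\<alpha>..\<beta>}) (\<lambda>p. Y (fst p) (snd p))"
    using Yc by (simp add: case_prod_unfold)
  have hc2: "continuous_on (UNIV \<times> {\<alpha>..\<beta>}) (\<lambda>(\<mu>, x). h \<mu> x)"
    unfolding h_def case_prod_unfold
    by (intro continuous_intros continuous_on_compose2[OF q] Yc2) auto
  have hc: "continuous_on {\<alpha>..\<beta>} (h \<mu>)" for \<mu>
    by (rule continuous_on_slice[OF hc2]) simp
  \<comment> \<open>The kernel has a corner at \<open>t = x\<close>. Split in this way, the integral
    is built from functions differentiable in \<open>x\<close>, and in its derivative the boundary
    terms \<open>x * h \<mu> x\<close> cancel.\<close>
  have split: "integral {\<alpha>..\<beta>} (\<lambda>t. max 0 (t - x) * h \<mu> t) =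
      integral {x..\<beta>} (\<lambda>t. t * h \<mu> t) - x * integral {x..\<beta>} (h \<mu>)"
    if x: "x \<in> {\<alpha>..\<beta>}" for \<mu> x
  proof -
    have "integral {\<alpha>..\<beta>} (\<lambda>t. max 0 (t - x) * h \<mu> t) =
        integral {\<alpha>..x} (\<lambda>t. max 0 (t - x) * h \<mu> t) + integral {x..\<beta>} (\<lambda>t. max 0 (t - x) * h \<mu> t)"
      using x by (intro Henstock_Kurzweil_Integration.integral_combine[symmetric])
        (auto intro!: integrable_continuous_real continuous_intros hc)
    also have "integral {\<alpha>..x} (\<lambda>t. max 0 (t - x) * h \<mu> t) = integral {\<alpha>..x} (\<lambda>t. 0)"
      by (rule integral_cong) auto
    also have "integral {x..\<beta>} (\<lambda>t. max 0 (t - x) * h \<mu> t) = integral {x..\<beta>} (\<lambda>t. t * h \<mu> t - x * h \<mu> t)"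
      by (rule integral_cong) (auto simp: algebra_simps)
    also have "\<dots> = integral {x..\<beta>} (\<lambda>t. t * h \<mu> t) - integral {x..\<beta>} (\<lambda>t. x * h \<mu> t)"
      using x by (intro integral_diff) (auto intro!: integrable_continuous_real continuous_intros
        continuous_on_subset[OF hc])
    finally show ?thesis by simp
  qed
  have Y': "Y \<mu> x = u \<mu> + v \<mu> * (x - \<beta>) + (integral {x..\<beta>} (\<lambda>t. t * h \<mu> t) - x * integral {x..\<beta>} (h \<mu>))"
    if x: "x \<in> {\<alpha>..\<beta>}" for \<mu> x
    using Y[OF x, of \<mu>] split[OF x, of \<mu>] by (simp add: h_def)
  show thesis
  proof
    show "Y \<mu> \<beta> = u \<mu>" for \<mu> using Y'[of \<beta> \<mu>] ab by simp
    show "Y1 \<mu> \<beta> = v \<mu>" for \<mu> by (simp add: Y1_def)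
    show "(Y1 \<mu> has_real_derivative (q x - \<mu>) * Y \<mu> x) (at x within {\<alpha>..\<beta>})"
      if x: "x \<in> {\<alpha>..\<beta>}" for \<mu> x
      unfolding Y1_def
      by (rule derivative_eq_intros integral_has_real_derivative'[OF hc x] refl)+
        (simp add: h_def)
    show "(Y \<mu> has_real_derivative Y1 \<mu> x) (at x within {\<alpha>..\<beta>})"
      if x: "x \<in> {\<alpha>..\<beta>}" for \<mu> x
    proof -
      have "continuous_on {\<alpha>..\<beta>} (\<lambda>t. t * h \<mu> t)" by (intro continuous_intros hc)
      note d = integral_has_real_derivative'[OF this x] integral_has_real_derivative'[OF hc x, of \<mu>]
      have "((\<lambda>x. u \<mu> + v \<mu> * (x - \<beta>) + (integral {x..\<beta>} (\<lambda>t. t * h \<mu> t) - x * integral {x..\<beta>} (h \<mu>)))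
          has_real_derivative Y1 \<mu> x) (at x within {\<alpha>..\<beta>})"
        by (rule derivative_eq_intros d refl)+ (simp add: Y1_def)
      then show ?thesis
        by (rule has_field_derivative_transform_within[OF _ zero_less_one x]) (use Y' in simp)
    qed
    show "continuous_on (UNIV \<times> {\<alpha>..\<beta>}) (\<lambda>(\<mu>, x). Y \<mu> x)" by (rule Yc)
    show "continuous_on UNIV (\<lambda>\<mu>. Y1 \<mu> \<alpha>)"
      unfolding Y1_def by (intro continuous_intros v continuous_on_integral_param hc2)
  qed
qed

text \<open>\<open>y\<close> is differentiated in the open interval only and merely continuous up to
  the ends: at the right end of a block followed by a gap, a Delta derivative is the difference
  quotient over the gap and not a one-sided derivative. Eigenfunctions are complex while the
  backward solution is real, hence the mixed types.\<close>

lemma wronskian_constant: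
  fixes y y1 :: "real \<Rightarrow> 'a::banach" and Z Z1 :: "real \<Rightarrow> real"
  assumes cont: "continuous_on {\<alpha>..\<beta>} y" "continuous_on {\<alpha>..\<beta>} y1"
    and y: "\<And>x. x \<in> {\<alpha><..<\<beta>} \<Longrightarrow> (y has_vector_derivative y1 x) (at x)"
    and y1: "\<And>x. x \<in> {\<alpha><..<\<beta>} \<Longrightarrow> (y1 has_vector_derivative r x *\<^sub>R y x) (at x)"
    and Z: "\<And>x. x \<in> {\<alpha>..\<beta>} \<Longrightarrow> (Z has_real_derivative Z1 x) (at x within {\<alpha>..\<beta>})"
    and Z1: "\<And>x. x \<in> {\<alpha>..\<beta>} \<Longrightarrow> (Z1 has_real_derivative r x * Z x) (at x within {\<alpha>..\<beta>})"
    and x: "x \<in> {\<alpha>..\<beta>}" and z: "z \<in> {\<alpha>..\<beta>}"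
  shows "Z1 x *\<^sub>R y x - Z x *\<^sub>R y1 x = Z1 z *\<^sub>R y z - Z z *\<^sub>R y1 z"
proof -
  let ?W = "\<lambda>x. Z1 x *\<^sub>R y x - Z x *\<^sub>R y1 x"
  have Zc: "continuous_on {\<alpha>..\<beta>} Z" "continuous_on {\<alpha>..\<beta>} Z1"
    by (rule DERIV_continuous_on, erule Z) (rule DERIV_continuous_on, erule Z1)
  have "?W x = ?W \<alpha>" if x: "x \<in> {\<alpha>..\<beta>}" for x
  proof (rule has_derivative_zero_unique_strong_interval[OF _ _ refl _ x])
    show "finite {\<alpha>, \<beta>}" by simp
    show "continuous_on {\<alpha>..\<beta>} ?W" by (intro continuous_intros cont Zc)
    fix x assume "x \<in> {\<alpha>..\<beta>} - {\<alpha>, \<beta>}"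
    then have x: "x \<in> {\<alpha><..<\<beta>}" "x \<in> {\<alpha>..\<beta>}" by auto
    have "(?W has_vector_derivative
        (Z1 x *\<^sub>R y1 x + (r x * Z x) *\<^sub>R y x) - (Z x *\<^sub>R (r x *\<^sub>R y x) + Z1 x *\<^sub>R y1 x)) (at x within {\<alpha>..\<beta>})"
      using y[OF x(1)] y1[OF x(1)] Z[OF x(2)] Z1[OF x(2)]
      by (intro has_vector_derivative_diff has_vector_derivative_scaleR)
        (auto intro: has_vector_derivative_at_within)
    then show "(?W has_derivative (\<lambda>h. 0)) (at x within {\<alpha>..\<beta>})"
      by (simp add: has_vector_derivative_def mult.commute)
  qed
  from this[OF x] this[OF z] show ?thesis by simp
qed

lemma real_derivative_interior:
  assumes "x \<in> {\<alpha><..<\<beta>}" "(f has_real_derivative D) (at x within {\<alpha>..\<beta>})"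
  shows "(f has_real_derivative D) (at x)"
  using assms by (metis at_within_Icc_at greaterThanLessThan_iff)

lemma linear_ivp_single:
  fixes \<mu> c d :: real
  assumes ab: "\<alpha> \<le> \<beta>" and q: "continuous_on {\<alpha>..\<beta>} q"
  shows "\<exists>Z Z1. Z \<beta> = c \<and> Z1 \<beta> = d \<and>
    (\<forall>x\<in>{\<alpha>..\<beta>}. (Z has_real_derivative Z1 x) (at x within {\<alpha>..\<beta>})) \<and>
    (\<forall>x\<in>{\<alpha>..\<beta>}. (Z1 has_real_derivative (q x - \<mu>) * Z x) (at x within {\<alpha>..\<beta>}))"
proof (rule linear_ivp[OF ab q continuous_on_const continuous_on_const, of c d])
  fix Y Y1 assume Y: "\<And>\<mu>. Y \<mu> \<beta> = c" "\<And>\<mu>. Y1 \<mu> \<beta> = d"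
    "\<And>\<mu> x. x \<in> {\<alpha>..\<beta>} \<Longrightarrow> (Y \<mu> has_real_derivative Y1 \<mu> x) (at x within {\<alpha>..\<beta>})"
    "\<And>\<mu> x. x \<in> {\<alpha>..\<beta>} \<Longrightarrow> (Y1 \<mu> has_real_derivative (q x - \<mu>) * Y \<mu> x) (at x within {\<alpha>..\<beta>})"
  show ?thesis
    by (rule exI[of _ "Y \<mu>"], rule exI[of _ "Y1 \<mu>"]) (use Y in blast)
qed

text \<open>\<open>y\<close> has zero Wronskian with each member of a real fundamental system
  \<open>C\<close>, \<open>S\<close> of determinant 1, and Cramer's rule recovers \<open>y\<close>
  and \<open>y1\<close> from these two Wronskians.\<close>

lemma linear_ivp_unique:
  fixes y y1 :: "real \<Rightarrow> 'a::banach"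
  assumes q: "continuous_on {\<alpha>..\<beta>} q"
    and cont: "continuous_on {\<alpha>..\<beta>} y" "continuous_on {\<alpha>..\<beta>} y1"
    and y: "\<And>x. x \<in> {\<alpha><..<\<beta>} \<Longrightarrow> (y has_vector_derivative y1 x) (at x)"
    and y1: "\<And>x. x \<in> {\<alpha><..<\<beta>} \<Longrightarrow> (y1 has_vector_derivative (q x - \<mu>) *\<^sub>R y x) (at x)"
    and c: "c \<in> {\<alpha>..\<beta>}" "y c = 0" "y1 c = 0" and x: "x \<in> {\<alpha>..\<beta>}"
  shows "y x = 0" "y1 x = 0"
proof -
  have ab: "\<alpha> \<le> \<beta>" using c(1) by simp
  obtain C C1 where C: "C \<beta> = 1" "C1 \<beta> = 0"
    "\<And>x. x \<in> {\<alpha>..\<beta>} \<Longrightarrow> (C has_real_derivative C1 x) (at x within {\<alpha>..\<beta>})"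
    "\<And>x. x \<in> {\<alpha>..\<beta>} \<Longrightarrow> (C1 has_real_derivative (q x - \<mu>) * C x) (at x within {\<alpha>..\<beta>})"
    using linear_ivp_single[OF ab q] by blast
  obtain S S1 where S: "S \<beta> = 0" "S1 \<beta> = 1"
    "\<And>x. x \<in> {\<alpha>..\<beta>} \<Longrightarrow> (S has_real_derivative S1 x) (at x within {\<alpha>..\<beta>})"
    "\<And>x. x \<in> {\<alpha>..\<beta>} \<Longrightarrow> (S1 has_real_derivative (q x - \<mu>) * S x) (at x within {\<alpha>..\<beta>})"
    using linear_ivp_single[OF ab q] by blast
  have yC: "C1 x *\<^sub>R y x - C x *\<^sub>R y1 x = 0"
    using wronskian_constant[OF cont y y1 C(3,4) x c(1)] c by simp
  have yS: "S1 x *\<^sub>R y x - S x *\<^sub>R y1 x = 0"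
    using wronskian_constant[OF cont y y1 S(3,4) x c(1)] c by simp
  have "S1 x *\<^sub>R C x - S x *\<^sub>R C1 x = S1 \<beta> *\<^sub>R C \<beta> - S \<beta> *\<^sub>R C1 \<beta>"
  proof (rule wronskian_constant[OF _ _ _ _ S(3,4) x])
    show "continuous_on {\<alpha>..\<beta>} (C)" "continuous_on {\<alpha>..\<beta>} (C1)"
      by (rule DERIV_continuous_on, erule C(3)) (rule DERIV_continuous_on, erule C(4))
    show "(C has_vector_derivative C1 x) (at x)" if "x \<in> {\<alpha><..<\<beta>}" for x
      using real_derivative_interior[OF that C(3)] that
      by (simp add: has_real_derivative_iff_has_vector_derivative)
    show "(C1 has_vector_derivative (q x - \<mu>) *\<^sub>R C x) (at x)" if "x \<in> {\<alpha><..<\<beta>}" for x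
      using real_derivative_interior[OF that C(4)] that
      by (simp add: has_real_derivative_iff_has_vector_derivative)
  qed (use ab in auto)
  then have det: "S1 x * C x - S x * C1 x = 1" using C S by simp
  have "y x = (S1 x * C x - S x * C1 x) *\<^sub>R y x" using det by simp
  also have "\<dots> = C x *\<^sub>R (S1 x *\<^sub>R y x - S x *\<^sub>R y1 x) - S x *\<^sub>R (C1 x *\<^sub>R y x - C x *\<^sub>R y1 x)"
    by (simp add: algebra_simps)
  finally show "y x = 0" using yC yS by simp
  have "y1 x = (S1 x * C x - S x * C1 x) *\<^sub>R y1 x" using det by simp
  also have "\<dots> = C1 x *\<^sub>R (S1 x *\<^sub>R y x - S x *\<^sub>R y1 x) - S1 x *\<^sub>R (C1 x *\<^sub>R y x - C x *\<^sub>R y1 x)"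
    by (simp add: algebra_simps)
  finally show "y1 x = 0" using yC yS by simp
qed

section \<open>Rotation of the initial data in the spectral parameter\<close>

text \<open>
  The derivative at \<open>\<nu> = \<mu>\<close> is \<open>u v' - v u'\<close>, the speed of rotation of \<open>(u, v)\<close> about the origin up to the
  factor \<open>u\<^sup>2 + v\<^sup>2\<close>; only continuity of \<open>u\<close> and \<open>v\<close> themselves has to be known.
\<close>

definition rotating :: "(real \<Rightarrow> real) \<Rightarrow> (real \<Rightarrow> real) \<Rightarrow> bool" where
  "rotating u v \<longleftrightarrow> continuous_on UNIV u \<and> continuous_on UNIV v \<and> (\<forall>\<mu>. u \<mu> \<noteq> 0 \<or> v \<mu> \<noteq> 0) \<and>
     (\<forall>\<mu>. \<exists>g\<ge>0. ((\<lambda>\<nu>. u \<mu> * v \<nu> - v \<mu> * u \<nu>) has_real_derivative g) (at \<mu>)) \<and>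
     (\<forall>\<^sub>F \<mu> in at_bot. u \<mu> * v \<mu> \<le> 0)"

text \<open>Kept apart from \<open>rotating\<close> because the initial data at the right end do not
  depend on \<mu> and thus rotate with speed zero.\<close>

definition strictly_rotating :: "(real \<Rightarrow> real) \<Rightarrow> (real \<Rightarrow> real) \<Rightarrow> bool" where
  "strictly_rotating u v \<longleftrightarrow> rotating u v \<and>
     (\<forall>\<mu>. \<exists>g>0. ((\<lambda>\<nu>. u \<mu> * v \<nu> - v \<mu> * u \<nu>) has_real_derivative g) (at \<mu>)) \<and>
     (\<forall>\<^sub>F \<mu> in at_bot. u \<mu> * v \<mu> < 0)"

text \<open>Caratheodory's criterion; it replaces differentiability of the solutions in the
  parameter.\<close>

lemma DERIV_linear_times_continuous:
  fixes f :: "real \<Rightarrow> real"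
  assumes "continuous_on UNIV f"
  shows "((\<lambda>\<nu>. (\<nu> - \<mu>) * f \<nu>) has_real_derivative f \<mu>) (at \<mu>)"
  unfolding CARAT_DERIV
  using assms by (intro exI[of _ f]) (auto simp: continuous_on_eq_continuous_at)

text \<open>Gaps and segments both change the bracket by a Lagrange identity with remainder
  \<open>(\<nu> - \<mu>) * G \<mu> \<nu>\<close>, so each adds \<open>G \<mu> \<mu>\<close> to the
  speed of rotation. The sign condition turns strict at the first update, whatever the
  speed.\<close>

lemma rotating_update:
  assumes uv: "rotating u v" and cont: "continuous_on UNIV u'" "continuous_on UNIV v'"
    and nz: "\<And>\<mu>. u' \<mu> \<noteq> 0 \<or> v' \<mu> \<noteq> 0"
    and W: "\<And>\<mu> \<nu>. u' \<mu> * v' \<nu> - v' \<mu> * u' \<nu> = u \<mu> * v \<nu> - v \<mu> * u \<nu> + (\<nu> - \<mu>) * G \<mu> \<nu>"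
    and G: "\<And>\<mu>. continuous_on UNIV (G \<mu>)" "\<And>\<mu>. G \<mu> \<mu> \<ge> 0"
    and low: "\<forall>\<^sub>F \<mu> in at_bot. u \<mu> * v \<mu> \<le> 0 \<longrightarrow> u' \<mu> * v' \<mu> < 0"
  shows "rotating u' v'"
    and "strictly_rotating u v \<or> (\<forall>\<mu>. G \<mu> \<mu> > 0) \<Longrightarrow> strictly_rotating u' v'"
proof -
  have D: "((\<lambda>\<nu>. u' \<mu> * v' \<nu> - v' \<mu> * u' \<nu>) has_real_derivative g + G \<mu> \<mu>) (at \<mu>)"
    if "((\<lambda>\<nu>. u \<mu> * v \<nu> - v \<mu> * u \<nu>) has_real_derivative g) (at \<mu>)" for g \<mu>
    unfolding W by (intro derivative_intros that DERIV_linear_times_continuous G)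
  have "\<forall>\<^sub>F \<mu> in at_bot. u \<mu> * v \<mu> \<le> 0" using uv by (simp add: rotating_def)
  with low have neg: "\<forall>\<^sub>F \<mu> in at_bot. u' \<mu> * v' \<mu> < 0" by eventually_elim auto
  show r: "rotating u' v'"
    unfolding rotating_def
  proof (intro conjI allI cont)
    show "u' \<mu> \<noteq> 0 \<or> v' \<mu> \<noteq> 0" for \<mu> by (rule nz)
    show "\<forall>\<^sub>F \<mu> in at_bot. u' \<mu> * v' \<mu> \<le> 0" using neg by eventually_elim auto
    fix \<mu>
    obtain g where "g \<ge> 0" "((\<lambda>\<nu>. u \<mu> * v \<nu> - v \<mu> * u \<nu>) has_real_derivative g) (at \<mu>)"
      using uv unfolding rotating_def by blast
    then show "\<exists>g\<ge>0. ((\<lambda>\<nu>. u' \<mu> * v' \<nu> - v' \<mu> * u' \<nu>) has_real_derivative g) (at \<mu>)"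
      using D G(2)[of \<mu>] by (intro exI[of _ "g + G \<mu> \<mu>"]) auto
  qed
  assume s: "strictly_rotating u v \<or> (\<forall>\<mu>. G \<mu> \<mu> > 0)"
  have "\<exists>g>0. ((\<lambda>\<nu>. u' \<mu> * v' \<nu> - v' \<mu> * u' \<nu>) has_real_derivative g) (at \<mu>)" for \<mu>
  proof -
    have "\<exists>g\<ge>0. ((\<lambda>\<nu>. u \<mu> * v \<nu> - v \<mu> * u \<nu>) has_real_derivative g) (at \<mu>) \<and> g + G \<mu> \<mu> > 0"
      using s
    proof
      assume "strictly_rotating u v"
      then obtain g where "g > 0" "((\<lambda>\<nu>. u \<mu> * v \<nu> - v \<mu> * u \<nu>) has_real_derivative g) (at \<mu>)"
        unfolding strictly_rotating_def by blast
      then show ?thesis using G(2)[of \<mu>] by (intro exI[of _ g]) auto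
    next
      assume "\<forall>\<mu>. G \<mu> \<mu> > 0"
      moreover obtain g where "g \<ge> 0" "((\<lambda>\<nu>. u \<mu> * v \<nu> - v \<mu> * u \<nu>) has_real_derivative g) (at \<mu>)"
        using uv unfolding rotating_def by blast
      ultimately show ?thesis by (intro exI[of _ g]) (auto simp: add_nonneg_pos)
    qed
    then show ?thesis using D by blast
  qed
  then show "strictly_rotating u' v'"
    using r neg by (simp add: strictly_rotating_def)
qed

text \<open>Crossing a gap backward is a product of two shears, which preserve the bracket at equal
  parameters. Only the first shear depends on the parameter, and this produces the remainder
  \<open>h * u \<mu> * u \<nu>\<close>.\<close>

lemma rotating_gap:
  assumes uv: "rotating u v" and h: "h > 0"
    and v': "\<And>\<mu>. v' \<mu> = v \<mu> - h * (c - \<mu>) * u \<mu>" and u': "\<And>\<mu>. u' \<mu> = u \<mu> - h * v' \<mu>"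
  shows "rotating u' v'"
    and "strictly_rotating u v \<or> (\<forall>\<mu>. u \<mu> \<noteq> 0) \<Longrightarrow> strictly_rotating u' v'"
proof -
  have uc: "continuous_on UNIV u" and vc: "continuous_on UNIV v" and nz: "\<And>\<mu>. u \<mu> \<noteq> 0 \<or> v \<mu> \<noteq> 0"
    using uv by (auto simp: rotating_def)
  have v'c: "continuous_on UNIV v'" unfolding v' by (intro continuous_intros uc vc)
  have u'c: "continuous_on UNIV u'" unfolding u' by (intro continuous_intros uc v'c)
  have nz': "u' \<mu> \<noteq> 0 \<or> v' \<mu> \<noteq> 0" for \<mu> using nz[of \<mu>] by (auto simp: u' v')
  have W: "u' \<mu> * v' \<nu> - v' \<mu> * u' \<nu> = u \<mu> * v \<nu> - v \<mu> * u \<nu> + (\<nu> - \<mu>) * (h * u \<mu> * u \<nu>)" for \<mu> \<nu>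
    by (simp add: u' v' algebra_simps)
  have low: "\<forall>\<^sub>F \<mu> in at_bot. u \<mu> * v \<mu> \<le> 0 \<longrightarrow> u' \<mu> * v' \<mu> < 0"
    using eventually_gt_at_bot[of c]
  proof eventually_elim
    case (elim \<mu>)
    \<comment> \<open>For \<open>\<mu> < c\<close> both subtracted squares have nonnegative
      coefficients, and they cannot vanish together.\<close>
    have "u' \<mu> * v' \<mu> = u \<mu> * v \<mu> - (h * (c - \<mu>) * (u \<mu>)\<^sup>2 + h * (v' \<mu>)\<^sup>2)"
      by (simp add: u' v' algebra_simps power2_eq_square)
    moreover have "h * (c - \<mu>) * (u \<mu>)\<^sup>2 + h * (v' \<mu>)\<^sup>2 > 0"
    proof (cases "u \<mu> = 0")
      case True
      then have "v' \<mu> \<noteq> 0" using nz[of \<mu>] by (simp add: v')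
      then show ?thesis using True h by simp
    next
      case False
      then show ?thesis using h elim by (intro add_pos_nonneg) auto
    qed
    ultimately show ?case by linarith
  qed
  have G: "continuous_on UNIV (\<lambda>\<nu>. h * u \<mu> * u \<nu>)" "0 \<le> h * u \<mu> * u \<mu>" for \<mu>
    using h by (auto intro!: continuous_intros uc simp: mult.assoc)
  show "rotating u' v'" by (rule rotating_update[OF uv u'c v'c nz' W G low])
  assume "strictly_rotating u v \<or> (\<forall>\<mu>. u \<mu> \<noteq> 0)"
  then have "strictly_rotating u v \<or> (\<forall>\<mu>. 0 < h * u \<mu> * u \<mu>)"
    using h by (auto simp: mult.assoc zero_less_mult_iff linorder_neq_iff)
  then show "strictly_rotating u' v'" by (rule rotating_update(2)[OF uv u'c v'c nz' W G low])
qed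

text \<open>By the Lagrange identity the remainder is the integral of
  \<open>Y \<mu> * Y \<nu>\<close>. On the diagonal this is positive on every nondegenerate segment,
  so a segment makes the rotation strict whatever came before.\<close>

lemma rotating_segment:
  assumes uv: "rotating u v" and ab: "\<alpha> < \<beta>" and q: "continuous_on {\<alpha>..\<beta>} q"
    and init: "\<And>\<mu>. Y \<mu> \<beta> = u \<mu>" "\<And>\<mu>. Y1 \<mu> \<beta> = v \<mu>"
    and Y: "\<And>\<mu> x. x \<in> {\<alpha>..\<beta>} \<Longrightarrow> (Y \<mu> has_real_derivative Y1 \<mu> x) (at x within {\<alpha>..\<beta>})"
    and Y1: "\<And>\<mu> x. x \<in> {\<alpha>..\<beta>} \<Longrightarrow> (Y1 \<mu> has_real_derivative (q x - \<mu>) * Y \<mu> x) (at x within {\<alpha>..\<beta>})"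
    and Yc: "continuous_on (UNIV \<times> {\<alpha>..\<beta>}) (\<lambda>(\<mu>, x). Y \<mu> x)"
    and Y1c: "continuous_on UNIV (\<lambda>\<mu>. Y1 \<mu> \<alpha>)"
  shows "strictly_rotating (\<lambda>\<mu>. Y \<mu> \<alpha>) (\<lambda>\<mu>. Y1 \<mu> \<alpha>)"
proof -
  have nz: "u \<mu> \<noteq> 0 \<or> v \<mu> \<noteq> 0" for \<mu>
    using uv by (auto simp: rotating_def)
  have Yx: "continuous_on {\<alpha>..\<beta>} (Y \<mu>)" and Y1x: "continuous_on {\<alpha>..\<beta>} (Y1 \<mu>)" for \<mu>
    by (rule DERIV_continuous_on, erule Y) (rule DERIV_continuous_on, erule Y1)
  have nzx: "Y \<mu> x \<noteq> 0 \<or> Y1 \<mu> x \<noteq> 0" if x: "x \<in> {\<alpha>..\<beta>}" for x \<mu>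
  proof (rule ccontr)
    assume "\<not> ?thesis"
    then have z: "Y \<mu> x = 0" "Y1 \<mu> x = 0" by auto
    have d: "(Y \<mu> has_vector_derivative Y1 \<mu> x) (at x)"
      "(Y1 \<mu> has_vector_derivative (q x - \<mu>) *\<^sub>R Y \<mu> x) (at x)" if "x \<in> {\<alpha><..<\<beta>}" for x
      using real_derivative_interior[OF that Y] real_derivative_interior[OF that Y1] that
      by (auto simp: has_real_derivative_iff_has_vector_derivative)
    have b: "\<beta> \<in> {\<alpha>..\<beta>}" using ab by simp
    show False
      using linear_ivp_unique[OF q Yx Y1x d x z b] init nz by metis
  qed
  define G where "G \<mu> \<nu> = integral {\<alpha>..\<beta>} (\<lambda>t. Y \<mu> t * Y \<nu> t)" for \<mu> \<nu>
  have W: "Y \<mu> \<alpha> * Y1 \<nu> \<alpha> - Y1 \<mu> \<alpha> * Y \<nu> \<alpha> = u \<mu> * v \<nu> - v \<mu> * u \<nu> + (\<nu> - \<mu>) * G \<mu> \<nu>" for \<mu> \<nu>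
  proof -
    let ?w = "\<lambda>x. Y \<mu> x * Y1 \<nu> x - Y1 \<mu> x * Y \<nu> x"
    have "(?w has_vector_derivative (\<mu> - \<nu>) * (Y \<mu> x * Y \<nu> x)) (at x within {\<alpha>..\<beta>})"
      if x: "x \<in> {\<alpha>..\<beta>}" for x
      unfolding has_real_derivative_iff_has_vector_derivative[symmetric]
      by (rule derivative_eq_intros Y[OF x] Y1[OF x] refl)+ (simp add: algebra_simps)
    then have "((\<lambda>x. (\<mu> - \<nu>) * (Y \<mu> x * Y \<nu> x)) has_integral ?w \<beta> - ?w \<alpha>) {\<alpha>..\<beta>}"
      using ab by (intro fundamental_theorem_of_calculus) auto
    then have "(\<mu> - \<nu>) * G \<mu> \<nu> = ?w \<beta> - ?w \<alpha>"
      unfolding G_def by (simp add: integral_unique flip: integral_mult_right)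
    then show ?thesis by (simp add: init algebra_simps)
  qed
  have Yc': "continuous_on (UNIV \<times> {\<alpha>..\<beta>}) (\<lambda>p. Y (fst p) (snd p))"
    using Yc by (simp add: case_prod_unfold)
  have Gc: "continuous_on UNIV (G \<mu>)" for \<mu>
    unfolding G_def
    by (rule continuous_on_integral_param)
      (auto simp: case_prod_unfold intro!: continuous_intros Yc' continuous_on_compose2[OF Yx])
  \<comment> \<open>If the integral of the square vanished, so would \<open>Y \<mu>\<close>, and at
    an interior point also its derivative, contrary to \<open>nzx\<close>.\<close>
  have Gpos: "G \<mu> \<mu> > 0" for \<mu>
  proof (rule ccontr)
    assume "\<not> ?thesis"
    have sc: "continuous_on {\<alpha>..\<beta>} (\<lambda>t. Y \<mu> t * Y \<mu> t)" by (intro continuous_intros Yx)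
    have "0 \<le> G \<mu> \<mu>" unfolding G_def by (rule integral_nonneg) (auto intro: integrable_continuous_real sc)
    with \<open>\<not> ?thesis\<close> have "G \<mu> \<mu> = 0" by simp
    then have "((\<lambda>t. Y \<mu> t * Y \<mu> t) has_integral 0) (cbox \<alpha> \<beta>)"
      using integrable_integral[OF integrable_continuous_real[OF sc]] by (simp add: G_def)
    then have zero: "Y \<mu> t = 0" if "t \<in> {\<alpha>..\<beta>}" for t
      using has_integral_0_cbox_imp_0[of \<alpha> \<beta> "\<lambda>t. Y \<mu> t * Y \<mu> t" t] sc ab that by auto
    define m where "m = (\<alpha> + \<beta>) / 2"
    have m: "m \<in> {\<alpha><..<\<beta>}" "m \<in> {\<alpha>..\<beta>}" using ab by (auto simp: m_def)
    have "(Y \<mu> has_real_derivative Y1 \<mu> m) (at m)"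
      using real_derivative_interior[OF m(1) Y[OF m(2)]] .
    moreover have "(Y \<mu> has_real_derivative 0) (at m)"
      by (rule has_field_derivative_transform_within_open[of "\<lambda>_. 0" _ _ "{\<alpha><..<\<beta>}"])
        (use m zero in auto)
    ultimately have "Y1 \<mu> m = 0" by (rule DERIV_unique)
    then show False using zero[OF m(2)] nzx[OF m(2)] by blast
  qed
  have low: "\<forall>\<^sub>F \<mu> in at_bot. u \<mu> * v \<mu> \<le> 0 \<longrightarrow> Y \<mu> \<alpha> * Y1 \<mu> \<alpha> < 0"
  proof -
    obtain B where B: "B > 0" "\<And>t. t \<in> {\<alpha>..\<beta>} \<Longrightarrow> \<bar>q t\<bar> \<le> B"
      using compact_imp_bounded[OF compact_continuous_image[OF q compact_Icc]]
      unfolding bounded_pos by force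
    show ?thesis
      using eventually_gt_at_bot[of "-B"]
    proof eventually_elim
      case (elim \<mu>)
      \<comment> \<open>Once \<open>\<mu>\<close> is below \<open>q\<close>, the product has
        derivative \<open>Y1^2 + (q - \<mu>) * Y^2 > 0\<close>; running backward it therefore drops
        below its nonpositive value at \<open>\<beta>\<close>.\<close>
      have "Y \<mu> \<alpha> * Y1 \<mu> \<alpha> < Y \<mu> \<beta> * Y1 \<mu> \<beta>"
      proof (rule DERIV_pos_imp_increasing_open[OF ab])
        show "continuous_on {\<alpha>..\<beta>} (\<lambda>x. Y \<mu> x * Y1 \<mu> x)" by (intro continuous_intros Yx Y1x)
        fix x assume "\<alpha> < x" "x < \<beta>"
        then have x: "x \<in> {\<alpha><..<\<beta>}" "x \<in> {\<alpha>..\<beta>}" by auto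
        have "((\<lambda>x. Y \<mu> x * Y1 \<mu> x) has_real_derivative (Y1 \<mu> x)\<^sup>2 + (q x - \<mu>) * (Y \<mu> x)\<^sup>2) (at x)"
          by (rule derivative_eq_intros real_derivative_interior[OF x(1) Y[OF x(2)]]
              real_derivative_interior[OF x(1) Y1[OF x(2)]] refl)+
            (simp add: power2_eq_square algebra_simps)
        moreover have "(Y1 \<mu> x)\<^sup>2 + (q x - \<mu>) * (Y \<mu> x)\<^sup>2 > 0"
        proof -
          have "q x - \<mu> > 0" using B(2)[OF x(2)] elim by linarith
          then show ?thesis using nzx[OF x(2), of \<mu>]
            by (cases "Y \<mu> x = 0") (auto intro: add_nonneg_pos)
        qed
        ultimately show "\<exists>D. ((\<lambda>x. Y \<mu> x * Y1 \<mu> x) has_real_derivative D) (at x) \<and> D > 0" by blast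
      qed
      then show ?case by (simp add: init)
    qed
  qed
  have Y\<alpha>: "continuous_on UNIV (\<lambda>\<mu>. Y \<mu> \<alpha>)"
    by (rule continuous_on_compose2[OF Yc', of UNIV "\<lambda>\<mu>. (\<mu>, \<alpha>)", simplified])
      (use ab in \<open>auto intro!: continuous_intros\<close>)
  show ?thesis
    by (rule rotating_update(2)[OF uv Y\<alpha> Y1c _ W Gc less_imp_le[OF Gpos] low])
      (use nzx[of \<alpha>] ab Gpos in auto)
qed

section \<open>Zeros of a planar curve with increasing phase\<close>

definition increasing_phase :: "(real \<Rightarrow> real) \<Rightarrow> (real \<Rightarrow> real) \<Rightarrow> bool" where
  "increasing_phase u v \<longleftrightarrow> continuous_on UNIV u \<and> continuous_on UNIV v \<and>
     (\<forall>\<mu>. \<exists>g>0. ((\<lambda>\<nu>. u \<mu> * v \<nu> - v \<mu> * u \<nu>) has_real_derivative g) (at \<mu>))"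

text \<open>A quarter turn preserves the bracket, so each fact about zeros of \<open>v\<close>
  yields one about zeros of \<open>u\<close>. It reverses the sign of \<open>u * v\<close> near
  minus infinity, which is why that condition is not part of
  \<open>increasing_phase\<close>.\<close>

lemma increasing_phase_swap:
  assumes "increasing_phase u v"
  shows "increasing_phase (\<lambda>\<mu>. - v \<mu>) u"
  using assms unfolding increasing_phase_def by (auto intro: continuous_intros simp: mult.commute)

lemma increasing_phase_nonzero:
  assumes "increasing_phase u v"
  shows "u \<mu> \<noteq> 0 \<or> v \<mu> \<noteq> 0"
proof (rule ccontr)
  assume "\<not> ?thesis"
  moreover obtain g where "g > 0" "((\<lambda>\<nu>. u \<mu> * v \<nu> - v \<mu> * u \<nu>) has_real_derivative g) (at \<mu>)"
    using assms unfolding increasing_phase_def by blast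
  ultimately show False using DERIV_unique[of "\<lambda>_. 0" g \<mu> 0] by auto
qed

lemma increasing_phase_quotient:
  assumes uv: "increasing_phase u v" and nz: "u \<mu> \<noteq> 0"
  shows "\<exists>D>0. ((\<lambda>\<nu>. v \<nu> / u \<nu>) has_real_derivative D) (at \<mu>)"
proof -
  obtain g where g: "g > 0" "((\<lambda>\<nu>. u \<mu> * v \<nu> - v \<mu> * u \<nu>) has_real_derivative g) (at \<mu>)"
    using assms unfolding increasing_phase_def by blast
  have u: "isCont u \<mu>" using uv by (simp add: increasing_phase_def continuous_on_eq_continuous_at)
  let ?w = "\<lambda>\<nu>. u \<mu> * v \<nu> - v \<mu> * u \<nu>"
  have "((\<lambda>\<nu>. (?w \<nu> - ?w \<mu>) / (\<nu> - \<mu>) / (u \<mu> * u \<nu>)) \<longlongrightarrow> g / (u \<mu> * u \<mu>)) (at \<mu>)"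
    using g(2) u nz unfolding has_field_derivative_iff isCont_def
    by (intro tendsto_intros) auto
  moreover have "\<forall>\<^sub>F \<nu> in at \<mu>. (?w \<nu> - ?w \<mu>) / (\<nu> - \<mu>) / (u \<mu> * u \<nu>) = (v \<nu> / u \<nu> - v \<mu> / u \<mu>) / (\<nu> - \<mu>)"
    using tendsto_imp_eventually_ne[OF u[unfolded isCont_def] nz]
      eventually_neq_at_within[of \<mu> \<mu> UNIV]
    by eventually_elim (use nz in \<open>simp add: field_simps\<close>)
  ultimately have "((\<lambda>\<nu>. (v \<nu> / u \<nu> - v \<mu> / u \<mu>) / (\<nu> - \<mu>)) \<longlongrightarrow> g / (u \<mu> * u \<mu>)) (at \<mu>)"
    by (rule Lim_transform_eventually)
  moreover have "g / (u \<mu> * u \<mu>) > 0" using g(1) nz not_real_square_gt_zero by (metis divide_pos_pos)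
  ultimately show ?thesis unfolding has_field_derivative_iff by blast
qed

text \<open>Otherwise \<open>v / u\<close> would be defined and strictly increasing between two
  points at which it is zero.\<close>

lemma increasing_phase_zero_between:
  assumes uv: "increasing_phase u v" and "\<mu> < \<nu>" "v \<mu> = 0" "v \<nu> = 0"
  shows "\<exists>z. \<mu> < z \<and> z < \<nu> \<and> u z = 0"
proof (rule ccontr)
  assume no: "\<not> ?thesis"
  have nz: "u z \<noteq> 0" if "\<mu> \<le> z" "z \<le> \<nu>" for z
    using that no assms(3,4) increasing_phase_nonzero[OF uv] by (metis order_le_less)
  have "v \<mu> / u \<mu> < v \<nu> / u \<nu>"
  proof (rule DERIV_pos_imp_increasing[OF \<open>\<mu> < \<nu>\<close>])
    fix z assume "\<mu> \<le> z" "z \<le> \<nu>"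
    then show "\<exists>D. ((\<lambda>z. v z / u z) has_real_derivative D) (at z) \<and> D > 0"
      using increasing_phase_quotient[OF uv nz] by blast
  qed
  then show False using assms by simp
qed

text \<open>If \<open>v\<close> had no zero below \<mu>, neither would \<open>u\<close>, by
  separation. The increasing function \<open>u / - v\<close> vanishes at \<mu>, so
  \<open>u * v > 0\<close> just to the left, while \<open>u * v < 0\<close> far to the left; the
  intermediate value theorem then gives a forbidden zero.\<close>

lemma increasing_phase_zero_below:
  assumes uv: "increasing_phase u v" and low: "\<forall>\<^sub>F \<mu> in at_bot. u \<mu> * v \<mu> < 0"
    and u0: "u \<mu> = 0"
  shows "\<exists>z<\<mu>. v z = 0"
proof (rule ccontr)
  assume no: "\<not> ?thesis"
  note swap = increasing_phase_swap[OF uv]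
  have v: "v z \<noteq> 0" if "z \<le> \<mu>" for z
    using no u0 increasing_phase_nonzero[OF uv] that by (metis order_le_less)
  have u: "u z \<noteq> 0" if "z < \<mu>" for z
    using increasing_phase_zero_between[OF swap that _ u0] v by fastforce
  obtain D where D: "D > 0" "((\<lambda>\<nu>. u \<nu> / - v \<nu>) has_real_derivative D) (at \<mu>)"
    using increasing_phase_quotient[OF swap, of \<mu>] v by auto
  obtain d where d: "d > 0" "\<And>h. h > 0 \<Longrightarrow> h < d \<Longrightarrow> u (\<mu> - h) / - v (\<mu> - h) < u \<mu> / - v \<mu>"
    using has_real_derivative_pos_inc_left[OF D(2,1)] by auto
  define t where "t = \<mu> - d / 2"
  have t: "t < \<mu>" using d(1) by (simp add: t_def)
  have "u t / - v t < 0" using d(2)[of "d / 2"] d(1) u0 by (simp add: t_def)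
  then have "u t * v t > 0" by (auto simp: divide_less_0_iff zero_less_divide_iff zero_less_mult_iff)
  moreover obtain b where b: "\<And>z. z \<le> b \<Longrightarrow> u z * v z < 0"
    using low unfolding eventually_at_bot_linorder by blast
  define s where "s = min b t"
  have "u s * v s < 0" "s \<le> t" using b by (auto simp: s_def)
  moreover have "continuous_on {s..t} (\<lambda>z. u z * v z)"
    using uv unfolding increasing_phase_def
    by (intro continuous_intros) (auto intro: continuous_on_subset)
  ultimately obtain z where "z \<le> t" "u z * v z = 0"
    using IVT'[of "\<lambda>z. u z * v z" s 0 t] by auto
  then show False using u[of z] v[of z] t by auto
qed

lemma strictly_rotating_increasing_phase: "strictly_rotating u v \<Longrightarrow> increasing_phase u v"
  by (simp add: strictly_rotating_def rotating_def increasing_phase_def)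

section \<open>Delta derivatives on finite unions of intervals\<close>

lemma has_delta_derivative_dense:
  fixes f :: "real \<Rightarrow> 'a::real_normed_vector"
  assumes "fjump T t = t" "t \<in> trunc T"
  shows "has_delta_derivative T f D t \<longleftrightarrow> (f has_vector_derivative D) (at t within T)"
proof -
  have "norm (f t - f s - (t - s) *\<^sub>R D) = norm (f s - f t - (s - t) *\<^sub>R D)" for s
    by (subst norm_minus_commute[symmetric]) (simp add: algebra_simps)
  moreover have "s \<in> {t - \<delta><..<t + \<delta>} \<longleftrightarrow> norm (s - t) < \<delta>" for s \<delta>
    by (auto simp: abs_less_iff)
  ultimately show ?thesis
    unfolding has_delta_derivative_def has_vector_derivative_def has_derivative_within_alt
    using assms by (simp add: bounded_linear_scaleR_left abs_minus_commute Ball_def Int_iff) blast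
qed

text \<open>The point \<open>r = t\<close> lies in every neighbourhood, so letting \<epsilon> tend
  to 0 forces the difference quotient over the gap; the remaining nearby points then force
  continuity, which matters when \<open>t\<close> is the right end of a segment.\<close>

lemma has_delta_derivative_scattered:
  fixes f :: "real \<Rightarrow> 'a::real_normed_vector"
  assumes jump: "fjump T t = s" "t < s" and t: "t \<in> trunc T" "t \<in> T"
  shows "has_delta_derivative T f D t \<longleftrightarrow>
    continuous (at t within T) f \<and> f s - f t = (s - t) *\<^sub>R D"
proof
  assume D: "has_delta_derivative T f D t"
  have *: "\<exists>\<delta>>0. \<forall>r \<in> {t - \<delta><..<t + \<delta>} \<inter> T. norm (f s - f r - (s - r) *\<^sub>R D) \<le> \<epsilon> * \<bar>s - r\<bar>"
    if "\<epsilon> > 0" for \<epsilon>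
    using D that unfolding has_delta_derivative_def jump by blast
  have small: "norm (f s - f t - (s - t) *\<^sub>R D) \<le> e" if "e > 0" for e
  proof -
    have "e / (s - t) > 0" using that jump by simp
    from *[OF this] obtain \<delta> where "\<delta> > 0"
      "\<forall>r \<in> {t - \<delta><..<t + \<delta>} \<inter> T. norm (f s - f r - (s - r) *\<^sub>R D) \<le> e / (s - t) * \<bar>s - r\<bar>"
      by blast
    then have "norm (f s - f t - (s - t) *\<^sub>R D) \<le> e / (s - t) * \<bar>s - t\<bar>"
      using t by auto
    then show ?thesis using jump by simp
  qed
  have "norm (f s - f t - (s - t) *\<^sub>R D) \<le> 0"
    by (rule field_le_epsilon) (use small in simp)
  then have eq: "f s - f t = (s - t) *\<^sub>R D" by simp
  moreover have "continuous (at t within T) f"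
    unfolding continuous_within_eps_delta
  proof (intro allI impI)
    fix e :: real assume e: "e > 0"
    \<comment> \<open>For \<open>r\<close> within \<open>s - t\<close> of \<open>t\<close>, the
      distance from \<open>s\<close> to \<open>r\<close> is at most \<open>2 * (s - t)\<close>, so
      this tolerance costs at most \<open>e / 2\<close>; the other half pays for
      \<open>(t - r) *\<^sub>R D\<close>.\<close>
    define \<epsilon> where "\<epsilon> = e / (4 * (s - t))"
    have "\<epsilon> > 0" using e jump by (simp add: \<epsilon>_def)
    from *[OF this] obtain \<delta> where \<delta>: "\<delta> > 0"
      "\<forall>r \<in> {t - \<delta><..<t + \<delta>} \<inter> T. norm (f s - f r - (s - r) *\<^sub>R D) \<le> \<epsilon> * \<bar>s - r\<bar>"
      by blast
    define d where "d = min \<delta> (min (s - t) (e / (2 * (norm D + 1))))"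
    have "d > 0" using \<delta>(1) jump e by (simp add: d_def add_nonneg_pos)
    moreover have "dist (f r) (f t) < e" if r: "r \<in> T" "dist r t < d" for r
    proof -
      have rt: "\<bar>t - r\<bar> < \<delta>" "\<bar>t - r\<bar> < s - t" "\<bar>t - r\<bar> < e / (2 * (norm D + 1))"
        using r(2) by (auto simp: d_def dist_real_def abs_minus_commute)
      have "norm (f s - f r - (s - r) *\<^sub>R D) \<le> \<epsilon> * \<bar>s - r\<bar>"
        using \<delta>(2) r(1) rt(1) by (auto simp: abs_less_iff)
      also have "\<dots> \<le> \<epsilon> * (2 * (s - t))"
        using rt(2) \<open>\<epsilon> > 0\<close> by (intro mult_left_mono) auto
      also have "\<dots> = e / 2" using jump by (simp add: \<epsilon>_def field_simps)
      finally have 1: "norm (f s - f r - (s - r) *\<^sub>R D) \<le> e / 2" .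
      have "norm ((t - r) *\<^sub>R D) \<le> \<bar>t - r\<bar> * (norm D + 1)"
        by (simp add: mult_left_mono)
      also have "\<dots> < e / (2 * (norm D + 1)) * (norm D + 1)"
        using rt(3) by (intro mult_strict_right_mono) (auto simp: add_nonneg_pos)
      also have "\<dots> = e / 2"
        by (simp add: field_simps add_eq_0_iff_both_eq_0 add_nonneg_eq_0_iff)
      finally have 2: "norm ((t - r) *\<^sub>R D) < e / 2" .
      have "f t - f r = (f s - f r - (s - r) *\<^sub>R D) + (t - r) *\<^sub>R D"
        using eq by (simp add: algebra_simps)
      then have "norm (f t - f r) \<le> norm (f s - f r - (s - r) *\<^sub>R D) + norm ((t - r) *\<^sub>R D)"
        by (metis norm_triangle_ineq)
      then show ?thesis using 1 2 by (simp add: dist_norm norm_minus_commute)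
    qed
    ultimately show "\<exists>d>0. \<forall>r\<in>T. dist r t < d \<longrightarrow> dist (f r) (f t) < e" by blast
  qed
  ultimately show "continuous (at t within T) f \<and> f s - f t = (s - t) *\<^sub>R D" by blast
next
  assume A: "continuous (at t within T) f \<and> f s - f t = (s - t) *\<^sub>R D"
  show "has_delta_derivative T f D t"
    unfolding has_delta_derivative_def jump
  proof (intro conjI allI impI t(1))
    fix \<epsilon> :: real assume \<epsilon>: "\<epsilon> > 0"
    have "continuous (at t within T) (\<lambda>r. f r + (s - r) *\<^sub>R D)"
      using A by (intro continuous_intros) auto
    moreover have "\<epsilon> * ((s - t) / 2) > 0" using \<epsilon> jump by simp
    ultimately obtain d where d: "d > 0"
      "\<And>r. r \<in> T \<Longrightarrow> dist r t < d \<Longrightarrow> dist (f r + (s - r) *\<^sub>R D) (f t + (s - t) *\<^sub>R D) < \<epsilon> * ((s - t) / 2)"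
      unfolding continuous_within_eps_delta by metis
    \<comment> \<open>Staying within half the gap keeps \<open>\<bar>s - r\<bar>\<close> at least
      \<open>(s - t) / 2\<close>, so a fixed continuity tolerance suffices.\<close>
    define \<delta> where "\<delta> = min d ((s - t) / 2)"
    have "norm (f s - f r - (s - r) *\<^sub>R D) \<le> \<epsilon> * \<bar>s - r\<bar>" if r: "r \<in> {t - \<delta><..<t + \<delta>} \<inter> T" for r
    proof -
      have "\<bar>t - r\<bar> < \<delta>" using r by (auto simp: abs_less_iff)
      then have rt: "dist r t < d" "\<bar>t - r\<bar> < (s - t) / 2"
        by (auto simp: \<delta>_def dist_real_def abs_minus_commute)
      have "f s = f t + (s - t) *\<^sub>R D" using A by (simp add: algebra_simps)
      then have "norm (f s - f r - (s - r) *\<^sub>R D) = dist (f r + (s - r) *\<^sub>R D) (f t + (s - t) *\<^sub>R D)"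
        unfolding dist_norm by (subst norm_minus_commute) (simp only: diff_diff_eq)
      then have "norm (f s - f r - (s - r) *\<^sub>R D) < \<epsilon> * ((s - t) / 2)"
        using d(2)[OF _ rt(1)] r by simp
      moreover have "(s - t) / 2 \<le> \<bar>s - r\<bar>" 
        using rt(2) abs_ge_self[of "s - r"] abs_ge_minus_self[of "t - r"] by argo
      then have "\<epsilon> * ((s - t) / 2) \<le> \<epsilon> * \<bar>s - r\<bar>" using \<epsilon> by simp
      ultimately show ?thesis by linarith
    qed
    moreover have "\<delta> > 0" using d(1) jump by (simp add: \<delta>_def)
    ultimately show "\<exists>\<delta>>0. \<forall>r\<in>{t - \<delta><..<t + \<delta>} \<inter> T. norm (f s - f r - (s - r) *\<^sub>R D) \<le> \<epsilon> * \<bar>s - r\<bar>"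
      by blast
  qed
qed

section \<open>Time scales made of finitely many blocks, with isolated points as degenerate
  blocks\<close>

locale block_scale =
  fixes a b :: "nat \<Rightarrow> real" and K :: nat
  assumes K: "1 \<le> K"
    and ab: "\<And>l. 1 \<le> l \<Longrightarrow> l \<le> K \<Longrightarrow> a l \<le> b l"
    and ba: "\<And>l. 1 \<le> l \<Longrightarrow> l < K \<Longrightarrow> b l < a (Suc l)"
begin

definition Ts :: "nat \<Rightarrow> real set" where
  "Ts k = (\<Union>l\<in>{1..k}. {a l..b l})"

text \<open>The block count after truncation; the prefixes \<open>Ts k\<close> are closed under it.
  A lone point is its own minimum, is fixed by \<open>bjump\<close> and so survives, hence
  \<open>2 \<le> k\<close>.\<close>

definition tr :: "nat \<Rightarrow> nat" where
  "tr k = (if 2 \<le> k \<and> a k = b k then k - 1 else k)"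

lemma tr_bounds: "1 \<le> k \<Longrightarrow> 1 \<le> tr k" "tr k \<le> k" "k \<le> Suc (tr k)"
  by (auto simp: tr_def)

lemma block_less: "1 \<le> l \<Longrightarrow> l < m \<Longrightarrow> m \<le> K \<Longrightarrow> b l < a m"
proof (induction m)
  case (Suc m)
  show ?case
  proof (cases "l = m")
    case False
    then have "b l < a m" "a m \<le> b m" "b m < a (Suc m)" using Suc ab[of m] ba[of m] by auto
    then show ?thesis by linarith
  qed (use Suc ba in auto)
qed simp

lemma gap_before: "2 \<le> l \<Longrightarrow> l \<le> K \<Longrightarrow> b (l - 1) < a l"
  using block_less[of "l - 1" l] by simp

lemma in_Ts: "x \<in> {a l..b l} \<Longrightarrow> 1 \<le> l \<Longrightarrow> l \<le> k \<Longrightarrow> x \<in> Ts k"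
  unfolding Ts_def by auto

lemma endpoints_in_Ts:
  assumes "1 \<le> l" "l \<le> k" "l \<le> K"
  shows "a l \<in> Ts k" "b l \<in> Ts k"
  using in_Ts[of "a l" l k] in_Ts[of "b l" l k] ab[of l] assms by auto

lemma Ts_cases:
  assumes "x \<in> Ts k"
  obtains l where "1 \<le> l" "l \<le> k" "x \<in> {a l..b l}"
  using assms unfolding Ts_def by auto

lemma Ts_before:
  assumes "x \<in> Ts k" "k \<le> K" "1 \<le> l" "l \<le> k" "x < a l"
  shows "2 \<le> l" "x \<le> b (l - 1)"
proof -
  obtain m where m: "1 \<le> m" "m \<le> k" "x \<in> {a m..b m}" using assms(1) by (rule Ts_cases)
  have "m < l"
    using block_less[of l m] ab[of l] assms m by (cases m l rule: linorder_cases) auto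
  then show "2 \<le> l" using m by simp
  show "x \<le> b (l - 1)"
  proof (cases "m = l - 1")
    case False
    then have "b m < a (l - 1)" "a (l - 1) \<le> b (l - 1)"
      using \<open>m < l\<close> m assms block_less[of m "l - 1"] ab[of "l - 1"] by auto
    then show ?thesis using m by simp
  qed (use m in simp)
qed

lemma Ts_after:
  assumes "x \<in> Ts k" "k \<le> K" "1 \<le> l" "l \<le> k" "b l < x"
  shows "l < k" "a (Suc l) \<le> x"
proof -
  obtain m where m: "1 \<le> m" "m \<le> k" "x \<in> {a m..b m}" using assms(1) by (rule Ts_cases)
  have "l < m"
    using block_less[of m l] ab[of l] assms m by (cases m l rule: linorder_cases) auto
  then show "l < k" using m by simp
  show "a (Suc l) \<le> x"
  proof (rule ccontr)
    assume "\<not> ?thesis"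
    then have "x < a (Suc l)" by simp
    from Ts_before(2)[OF assms(1,2) _ _ this] \<open>l < k\<close> assms show False by simp
  qed
qed

lemma Ts_bounds:
  assumes "x \<in> Ts k" "k \<le> K"
  shows "a 1 \<le> x" "x \<le> b k"
  using Ts_before[OF assms, of 1] Ts_after[OF assms, of k] assms(1)
  by (force elim: Ts_cases)+

lemma Sup_Ts: "1 \<le> k \<Longrightarrow> k \<le> K \<Longrightarrow> Sup (Ts k) = b k"
  by (rule cSup_eq_maximum) (use endpoints_in_Ts[of k k] Ts_bounds[of _ k] in auto)

lemma Inf_Ts: "1 \<le> k \<Longrightarrow> k \<le> K \<Longrightarrow> Inf (Ts k) = a 1"
  by (rule cInf_eq_minimum) (use endpoints_in_Ts[of 1 k] Ts_bounds[of _ k] in auto)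

lemma block_end_le: "1 \<le> l \<Longrightarrow> l \<le> k \<Longrightarrow> k \<le> K \<Longrightarrow> b l \<le> b k"
  using Ts_bounds(2)[OF in_Ts[of "b l" l k]] ab[of l] by simp

lemma fjump_inner:
  assumes "1 \<le> l" "l \<le> k" "k \<le> K" "x \<in> {a l..<b l}"
  shows "fjump (Ts k) x = x"
proof -
  let ?S = "{s \<in> Ts k. x < s}"
  have sub: "{x<..b l} \<subseteq> ?S" using assms by (auto intro!: in_Ts[of _ l])
  have "Inf ?S \<le> Inf {x<..b l}"
    by (rule cInf_superset_mono) (use assms sub in \<open>auto intro!: bdd_belowI[of _ x]\<close>)
  then have "Inf ?S \<le> x" using assms by simp
  moreover have "x \<le> Inf ?S" by (rule cInf_greatest) (use sub assms in fastforce)+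
  moreover have "x \<noteq> Sup (Ts k)" using Sup_Ts[of k] block_end_le[of l k] assms by auto
  ultimately show ?thesis by (simp add: fjump_def)
qed

lemma fjump_end:
  assumes "1 \<le> l" "l < k" "k \<le> K"
  shows "fjump (Ts k) (b l) = a (Suc l)"
proof -
  have "Inf {s \<in> Ts k. b l < s} = a (Suc l)"
    by (rule cInf_eq_minimum)
      (use assms endpoints_in_Ts[of "Suc l" k] ba[of l] Ts_after(2)[of _ k l] in auto)
  moreover have "b l < b k"
    using block_less[of l k] ab[of k] assms by force
  ultimately show ?thesis using Sup_Ts[of k] assms by (simp add: fjump_def)
qed

lemma fjump_last: "1 \<le> k \<Longrightarrow> k \<le> K \<Longrightarrow> fjump (Ts k) (b k) = b k"
  by (simp add: fjump_def Sup_Ts)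

lemma left_isolated_start:
  assumes "2 \<le> l" "l \<le> k" "k \<le> K"
  shows "left_isolated (Ts k) (a l)"
proof -
  have "Sup {s \<in> Ts k. s < a l} = b (l - 1)"
    by (rule cSup_eq_maximum)
      (use assms endpoints_in_Ts[of "l - 1" k] gap_before[of l] Ts_before(2)[of _ k l] in auto)
  moreover have "b (l - 1) < a l" using gap_before[of l] assms by simp
  moreover have "a 1 < a l" using block_less[of 1 l] ab[of 1] assms by force
  ultimately show ?thesis
    using assms Inf_Ts[of k] by (simp add: left_isolated_def bjump_def)
qed

lemma not_left_isolated_first: "1 \<le> k \<Longrightarrow> k \<le> K \<Longrightarrow> \<not> left_isolated (Ts k) (a 1)"
  by (simp add: left_isolated_def bjump_def Inf_Ts)

lemma not_left_isolated_inner: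
  assumes "1 \<le> l" "l \<le> k" "k \<le> K" "x \<in> {a l<..b l}"
  shows "\<not> left_isolated (Ts k) x"
proof -
  let ?S = "{s \<in> Ts k. s < x}"
  have sub: "{a l..<x} \<subseteq> ?S" using assms by (auto intro!: in_Ts[of _ l])
  have "Sup {a l..<x} \<le> Sup ?S"
    by (rule cSup_subset_mono) (use assms sub in \<open>auto intro!: bdd_aboveI[of _ x]\<close>)
  then have "x \<le> Sup ?S" using assms by simp
  moreover have "x \<noteq> Inf (Ts k)"
    using Inf_Ts[of k] Ts_bounds(1)[OF in_Ts[of "a l" l k]] ab[of l] assms by auto
  ultimately show ?thesis by (simp add: left_isolated_def bjump_def)
qed

lemma trunc_Ts:
  assumes "1 \<le> k" "k \<le> K"
  shows "trunc (Ts k) = Ts (tr k)"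
proof (cases "2 \<le> k \<and> a k = b k")
  case True
  then have "left_isolated (Ts k) (Sup (Ts k))"
    using left_isolated_start[of k k] Sup_Ts[of k] assms by simp
  moreover have "Ts k - {b k} = Ts (k - 1)"
  proof -
    have "{1..k} = insert k {1..k - 1}" using assms by auto
    then have "Ts k = insert (b k) (Ts (k - 1))" using True by (simp add: Ts_def)
    moreover have "b k \<notin> Ts (k - 1)"
      using Ts_bounds(2)[of "b k" "k - 1"] gap_before[of k] True assms by fastforce
    ultimately show ?thesis by simp
  qed
  ultimately show ?thesis using True Sup_Ts[of k] assms by (simp add: trunc_def tr_def)
next
  case False
  have "\<not> left_isolated (Ts k) (b k)"
  proof (cases "k = 1 \<and> a k = b k")
    case True
    then show ?thesis using not_left_isolated_first[of k] assms by metis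
  next
    case F: False
    then have "a k \<noteq> b k" using False assms(1) by (cases "k = 1") auto
    then have "a k < b k" using ab[of k] assms by simp
    then show ?thesis using not_left_isolated_inner[of k k "b k"] assms by simp
  qed
  then show ?thesis using False Sup_Ts[of k] assms by (auto simp: trunc_def tr_def)
qed

lemma at_within_Ts:
  assumes "1 \<le> l" "l \<le> k" "k \<le> K" "x \<in> {a l..b l}"
  shows "at x within Ts k = at x within {a l..b l}"
proof (rule at_within_nhd)
  let ?U = "(if l = 1 then UNIV else {b (l - 1)<..}) \<inter> (if l = k then UNIV else {..<a (Suc l)})"
  show "open ?U" by (intro open_Int) auto
  show "x \<in> ?U" using assms gap_before[of l] ba[of l] by auto
  have "Ts k \<inter> ?U = {a l..b l} \<inter> ?U"
  proof (intro equalityI subsetI)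
    fix s assume s: "s \<in> Ts k \<inter> ?U"
    have "\<not> s < a l" using Ts_before[of s k l] s assms by (auto split: if_splits)
    moreover have "\<not> b l < s" using Ts_after[of s k l] s assms by (auto split: if_splits)
    ultimately show "s \<in> {a l..b l} \<inter> ?U" using s by auto
  qed (use assms in \<open>auto intro: in_Ts[of _ l]\<close>)
  then show "Ts k \<inter> ?U - {x} = {a l..b l} \<inter> ?U - {x}" by simp
qed

text \<open>\<open>x < b l \<or> l = k\<close> describes the points fixed by the jump operator; the
  maximum is among them, and there the derivative is the left one.\<close>

lemma delta_inner_iff:
  fixes f :: "real \<Rightarrow> 'a::real_normed_vector"
  assumes "1 \<le> l" "l \<le> tr k" "k \<le> K" "x \<in> {a l..b l}" "x < b l \<or> l = k"
  shows "has_delta_derivative (Ts k) f D x \<longleftrightarrow> (f has_vector_derivative D) (at x within {a l..b l})"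
proof -
  have l: "l \<le> k" using assms tr_bounds(2)[of k] by simp
  then have k: "1 \<le> k" using assms by simp
  have "fjump (Ts k) x = x"
    using fjump_inner[of l k x] fjump_last[of k] assms l k by force
  moreover have "x \<in> trunc (Ts k)" using assms k by (simp add: trunc_Ts in_Ts)
  ultimately show ?thesis
    using has_delta_derivative_dense at_within_Ts[of l k x] assms l by metis
qed

lemma delta_end_iff:
  fixes f :: "real \<Rightarrow> 'a::real_normed_vector"
  assumes "1 \<le> l" "l < k" "k \<le> K"
  shows "has_delta_derivative (Ts k) f D (b l) \<longleftrightarrow>
    continuous (at (b l) within {a l..b l}) f \<and> f (a (Suc l)) - f (b l) = (a (Suc l) - b l) *\<^sub>R D"
proof -
  have bl: "b l \<in> {a l..b l}" using ab assms by simp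
  have "l \<le> tr k" using assms tr_bounds(3)[of k] by simp
  then have "b l \<in> trunc (Ts k)" using endpoints_in_Ts(2)[of l "tr k"] assms by (simp add: trunc_Ts)
  moreover have "b l \<in> Ts k" using bl assms by (auto intro: in_Ts)
  ultimately show ?thesis
    using has_delta_derivative_scattered[OF fjump_end ba, of l k f D] at_within_Ts[of l k "b l"] assms bl
    by simp
qed

text \<open>Excluding the one-point time scale makes the block nondegenerate in the first case. This
  is what uniqueness of the derivative requires, since on a single point every \<open>D\<close> is a
  derivative.\<close>

lemma delta_cases:
  assumes "x \<in> Ts (tr k)" "1 \<le> k" "k \<le> K" "2 \<le> k \<or> a 1 < b 1"
  obtains (inner) l where "1 \<le> l" "l \<le> tr k" "x \<in> {a l..b l}" "a l < b l" "x < b l \<or> l = k"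
    | (jump) l where "1 \<le> l" "l < k" "x = b l"
proof -
  obtain l where l: "1 \<le> l" "l \<le> tr k" "x \<in> {a l..b l}" using assms(1) by (rule Ts_cases)
  show thesis
  proof (cases "x < b l \<or> l = k")
    case True
    moreover have "a l < b l"
    proof (cases "x < b l")
      case False
      with True have "l = k" by simp
      have "a k \<noteq> b k"
      proof (cases "2 \<le> k")
        case True
        then show ?thesis using l \<open>l = k\<close> by (auto simp: tr_def)
      next
        case False
        then have "k = 1" using assms by simp
        then show ?thesis using assms by simp
      qed
      then show ?thesis using l \<open>l = k\<close> by simp
    qed (use l in simp)
    ultimately show ?thesis using inner l by blast
  next
    case False
    then show ?thesis using jump[of l] l tr_bounds(2)[of k] by auto
  qed
qed

lemma delta_deriv_eq:
  fixes f :: "real \<Rightarrow> 'a::real_normed_vector"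
  assumes D: "has_delta_derivative (Ts k) f D x"
    and k: "1 \<le> k" "k \<le> K" "2 \<le> k \<or> a 1 < b 1"
  shows "delta_deriv (Ts k) f x = D"
  unfolding delta_deriv_def
proof (rule the_equality[where P = "\<lambda>D. has_delta_derivative (Ts k) f D x", OF D])
  fix D' assume D': "has_delta_derivative (Ts k) f D' x"
  have "x \<in> Ts (tr k)" using D k trunc_Ts[of k] by (simp add: has_delta_derivative_def)
  then show "D' = D"
    using k
  proof (cases rule: delta_cases)
    case (inner l)
    then have "(f has_vector_derivative D) (at x within {a l..b l})"
      "(f has_vector_derivative D') (at x within {a l..b l})"
      using D D' delta_inner_iff[of l k x] k by auto
    then show ?thesis
      using vector_derivative_unique_within_closed_interval[of "a l" "b l" x f] inner by auto
  next
    case (jump l)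
    then have "(a (Suc l) - b l) *\<^sub>R D = (a (Suc l) - b l) *\<^sub>R D'"
      using D D' delta_end_iff[of l k f] k by metis
    then show ?thesis using ba[of l] jump k by simp
  qed
qed

lemma delta_differentiable_deriv:
  fixes f :: "real \<Rightarrow> 'a::real_normed_vector"
  assumes "delta_differentiable (Ts k) f x" "1 \<le> k" "k \<le> K" "2 \<le> k \<or> a 1 < b 1"
  shows "has_delta_derivative (Ts k) f (delta_deriv (Ts k) f x) x"
  using assms delta_deriv_eq unfolding delta_differentiable_def by metis

lemma delta_derivative_continuous:
  fixes f :: "real \<Rightarrow> 'a::real_normed_vector"
  assumes "has_delta_derivative (Ts k) f D x" "1 \<le> l" "l \<le> tr k" "k \<le> K" "x \<in> {a l..b l}"
  shows "continuous (at x within {a l..b l}) f"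
proof (cases "x < b l \<or> l = k")
  case True
  then show ?thesis
    using assms delta_inner_iff[of l k x f D] by (auto intro: has_vector_derivative_continuous)
next
  case False
  then show ?thesis
    using assms delta_end_iff[of l k f D] tr_bounds(2)[of k] by auto
qed

end

section \<open>Eigenvalues as zeros of the backward solution\<close>

text \<open>A one-point block passes its data on unchanged and its differential equation is vacuous,
  so segments and isolated points share one induction step.\<close>

lemma rotating_block:
  assumes uv: "rotating u v" and ab: "\<alpha> \<le> \<beta>" and q: "continuous_on {\<alpha>..\<beta>} q"
  obtains Z Z1 :: "real \<Rightarrow> real \<Rightarrow> real" where
    "\<And>\<mu>. Z \<mu> \<beta> = u \<mu>" "\<And>\<mu>. Z1 \<mu> \<beta> = v \<mu>"
    "\<And>\<mu> x. x \<in> {\<alpha>..\<beta>} \<Longrightarrow> (Z \<mu> has_real_derivative Z1 \<mu> x) (at x within {\<alpha>..\<beta>})"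
    "\<And>\<mu> x. x \<in> {\<alpha>..\<beta>} \<Longrightarrow> (Z1 \<mu> has_real_derivative (q x - \<mu>) * Z \<mu> x) (at x within {\<alpha>..\<beta>})"
    "rotating (\<lambda>\<mu>. Z \<mu> \<alpha>) (\<lambda>\<mu>. Z1 \<mu> \<alpha>)"
    "\<alpha> < \<beta> \<or> strictly_rotating u v \<Longrightarrow> strictly_rotating (\<lambda>\<mu>. Z \<mu> \<alpha>) (\<lambda>\<mu>. Z1 \<mu> \<alpha>)"
proof -
  have "continuous_on UNIV u" "continuous_on UNIV v" using uv by (auto simp: rotating_def)
  then obtain Z Z1 where Z: "\<And>\<mu>. Z \<mu> \<beta> = u \<mu>" "\<And>\<mu>. Z1 \<mu> \<beta> = v \<mu>"
    "\<And>\<mu> x. x \<in> {\<alpha>..\<beta>} \<Longrightarrow> (Z \<mu> has_real_derivative Z1 \<mu> x) (at x within {\<alpha>..\<beta>})"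
    "\<And>\<mu> x. x \<in> {\<alpha>..\<beta>} \<Longrightarrow> (Z1 \<mu> has_real_derivative (q x - \<mu>) * Z \<mu> x) (at x within {\<alpha>..\<beta>})"
    "continuous_on (UNIV \<times> {\<alpha>..\<beta>}) (\<lambda>(\<mu>, x). Z \<mu> x)" "continuous_on UNIV (\<lambda>\<mu>. Z1 \<mu> \<alpha>)"
    by (rule linear_ivp[OF ab q]) blast
  show thesis
  proof (cases "\<alpha> < \<beta>")
    case True
    then have "strictly_rotating (\<lambda>\<mu>. Z \<mu> \<alpha>) (\<lambda>\<mu>. Z1 \<mu> \<alpha>)"
      by (rule rotating_segment[OF uv _ q Z])
    then show ?thesis using that[of Z Z1] Z by (auto simp: strictly_rotating_def)
  next
    case False
    then have "\<alpha> = \<beta>" using ab by simp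
    then have "(\<lambda>\<mu>. Z \<mu> \<alpha>) = u" "(\<lambda>\<mu>. Z1 \<mu> \<alpha>) = v" using Z(1,2) by auto
    then show ?thesis using that[of Z Z1] Z(1-4) uv \<open>\<alpha> = \<beta>\<close> by auto
  qed
qed

lemma rotating_const: "rotating (\<lambda>_. 0) (\<lambda>_. -1)"
  by (auto simp: rotating_def intro!: exI[of _ 0])

lemma rd_continuous_on_cong:
  assumes "\<And>t. t \<in> B \<Longrightarrow> f t = g t"
  shows "rd_continuous_on S B f \<longleftrightarrow> rd_continuous_on S B g"
proof -
  have "(f \<longlongrightarrow> L) (at t within B') \<longleftrightarrow> (g \<longlongrightarrow> L) (at t within B')" if "B' \<subseteq> B" for B' t L
    by (rule Lim_cong_within) (use that assms in auto)
  then show ?thesis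
    using assms by (simp add: rd_continuous_on_def continuous_within cong: ball_cong)
qed

section \<open>The backward solution on all blocks\<close>

context block_scale
begin

text \<open>The second gap equation is imposed even in front of an isolated maximum, where the
  problem prescribes none. Since \<open>Y\<close> vanishes at the maximum, it only says there that
  \<open>Y1\<close> equals -1 at the left end of the gap too, and the value of \<open>q\<close> does
  not enter.\<close>

definition backward_from ::
    "nat \<Rightarrow> (real \<Rightarrow> real) \<Rightarrow> (real \<Rightarrow> real \<Rightarrow> real) \<Rightarrow> (real \<Rightarrow> real \<Rightarrow> real) \<Rightarrow> bool" where
  "backward_from j q Y Y1 \<longleftrightarrow>
     (\<forall>\<mu>. Y \<mu> (b K) = 0 \<and> Y1 \<mu> (b K) = -1) \<and>
     (\<forall>l\<in>{j..K}. \<forall>\<mu>. \<forall>x\<in>{a l..b l}.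
        (Y \<mu> has_real_derivative Y1 \<mu> x) (at x within {a l..b l}) \<and>
        (Y1 \<mu> has_real_derivative (q x - \<mu>) * Y \<mu> x) (at x within {a l..b l})) \<and>
     (\<forall>l\<in>{j..<K}. \<forall>\<mu>.
        Y \<mu> (a (Suc l)) = Y \<mu> (b l) + (a (Suc l) - b l) * Y1 \<mu> (b l) \<and>
        Y1 \<mu> (a (Suc l)) = Y1 \<mu> (b l) + (a (Suc l) - b l) * ((q (b l) - \<mu>) * Y \<mu> (a (Suc l))))"

lemma backward_from_extend:
  assumes Y: "backward_from (Suc n) q Y Y1" and n: "1 \<le> n" "n < K"
    and Z: "\<And>\<mu> x. x \<in> {a n..b n} \<Longrightarrow> (Z \<mu> has_real_derivative Z1 \<mu> x) (at x within {a n..b n})"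
    and Z1: "\<And>\<mu> x. x \<in> {a n..b n} \<Longrightarrow> (Z1 \<mu> has_real_derivative (q x - \<mu>) * Z \<mu> x) (at x within {a n..b n})"
    and gap: "\<And>\<mu>. Y \<mu> (a (Suc n)) = Z \<mu> (b n) + (a (Suc n) - b n) * Z1 \<mu> (b n)"
      "\<And>\<mu>. Y1 \<mu> (a (Suc n)) = Z1 \<mu> (b n) + (a (Suc n) - b n) * ((q (b n) - \<mu>) * Y \<mu> (a (Suc n)))"
  shows "backward_from n q (\<lambda>\<mu> x. if x \<le> b n then Z \<mu> x else Y \<mu> x)
    (\<lambda>\<mu> x. if x \<le> b n then Z1 \<mu> x else Y1 \<mu> x)" (is "backward_from n q ?Y ?Y1")
proof -
  have later: "x > b n" if "Suc n \<le> l" "l \<le> K" "x \<in> {a l..b l}" for x l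
    using block_less[of n l] n that by auto
  have endpoints: "a l \<in> {a l..b l}" "b l \<in> {a l..b l}" if "Suc n \<le> l" "l \<le> K" for l
    using ab[of l] that by auto
  note la = later[OF _ _ endpoints(1)] and lb = later[OF _ _ endpoints(2)]
  show ?thesis
    unfolding backward_from_def
  proof (intro conjI allI ballI)
    show "?Y \<mu> (b K) = 0" "?Y1 \<mu> (b K) = -1" for \<mu>
      using Y lb[of K] n by (auto simp: backward_from_def)
  next
    fix l \<mu> x assume l: "l \<in> {n..K}" and x: "x \<in> {a l..b l}"
    have "(?Y \<mu> has_real_derivative ?Y1 \<mu> x) (at x within {a l..b l}) \<and>
      (?Y1 \<mu> has_real_derivative (q x - \<mu>) * ?Y \<mu> x) (at x within {a l..b l})"
    proof (cases "l = n")
      case True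
      have "(?Y \<mu> has_real_derivative Z1 \<mu> x) (at x within {a n..b n})"
        by (rule has_field_derivative_transform_within[OF Z zero_less_one]) (use x True in auto)
      moreover have "(?Y1 \<mu> has_real_derivative (q x - \<mu>) * Z \<mu> x) (at x within {a n..b n})"
        by (rule has_field_derivative_transform_within[OF Z1 zero_less_one]) (use x True in auto)
      ultimately show ?thesis using x True by auto
    next
      case False
      then have l: "Suc n \<le> l" "l \<le> K" using l by auto
      have D: "(Y \<mu> has_real_derivative Y1 \<mu> x) (at x within {a l..b l})"
        "(Y1 \<mu> has_real_derivative (q x - \<mu>) * Y \<mu> x) (at x within {a l..b l})"
        using Y l x unfolding backward_from_def by auto
      have e: "\<not> s \<le> b n" if "s \<in> {a l..b l}" for s using later[OF l that] by simp
      have "(?Y \<mu> has_real_derivative Y1 \<mu> x) (at x within {a l..b l})"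
        by (rule has_field_derivative_transform_within[OF D(1) zero_less_one x]) (simp add: e)
      moreover have "(?Y1 \<mu> has_real_derivative (q x - \<mu>) * Y \<mu> x) (at x within {a l..b l})"
        by (rule has_field_derivative_transform_within[OF D(2) zero_less_one x]) (simp add: e)
      ultimately show ?thesis using e[OF x] by simp
    qed
    then show "(?Y \<mu> has_real_derivative ?Y1 \<mu> x) (at x within {a l..b l})"
      "(?Y1 \<mu> has_real_derivative (q x - \<mu>) * ?Y \<mu> x) (at x within {a l..b l})" by auto
  next
    fix l \<mu> assume l: "l \<in> {n..<K}"
    have "b n < a (Suc l)" using la[of "Suc l"] l by simp
    moreover have "l \<noteq> n \<Longrightarrow> b n < b l" using lb[of l] l by simp
    ultimately have "?Y \<mu> (a (Suc l)) = ?Y \<mu> (b l) + (a (Suc l) - b l) * ?Y1 \<mu> (b l) \<and>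
      ?Y1 \<mu> (a (Suc l)) = ?Y1 \<mu> (b l) + (a (Suc l) - b l) * ((q (b l) - \<mu>) * ?Y \<mu> (a (Suc l)))"
      using gap[of \<mu>] Y l unfolding backward_from_def by (cases "l = n") auto
    then show "?Y \<mu> (a (Suc l)) = ?Y \<mu> (b l) + (a (Suc l) - b l) * ?Y1 \<mu> (b l)"
      "?Y1 \<mu> (a (Suc l)) = ?Y1 \<mu> (b l) + (a (Suc l) - b l) * ((q (b l) - \<mu>) * ?Y \<mu> (a (Suc l)))"
      by auto
  qed
qed

lemma backward_solution_exists:
  assumes q: "\<And>l. 1 \<le> l \<Longrightarrow> l \<le> K \<Longrightarrow> continuous_on {a l..b l} q"
    and large: "(\<exists>l\<in>{1..K}. a l < b l) \<or> 3 \<le> K"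
  obtains Y Y1 where "backward_from 1 q Y Y1"
    "strictly_rotating (\<lambda>\<mu>. Y \<mu> (a 1)) (\<lambda>\<mu>. Y1 \<mu> (a 1))"
proof -
  \<comment> \<open>Rotation becomes strict at the first segment, or at the first gap whose right end has \<open>Y \<noteq> 0\<close>;
    with isolated points only, that is the second gap, since \<open>Y\<close> vanishes at the last point.\<close>
  let ?P = "\<lambda>j. \<exists>Y Y1. backward_from j q Y Y1 \<and> rotating (\<lambda>\<mu>. Y \<mu> (a j)) (\<lambda>\<mu>. Y1 \<mu> (a j)) \<and>
    (strictly_rotating (\<lambda>\<mu>. Y \<mu> (a j)) (\<lambda>\<mu>. Y1 \<mu> (a j)) \<or>
     (\<forall>l\<in>{j..K}. a l = b l) \<and>
       (j = K \<and> (\<forall>\<mu>. Y \<mu> (a j) = 0) \<or> Suc j = K \<and> (\<forall>\<mu>. Y \<mu> (a j) \<noteq> 0)))"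
  have "?P 1"
  proof (rule inc_induct[where i = 1 and j = K and P = ?P])
    show "1 \<le> K" by (rule K)
    show "?P K"
    proof (rule rotating_block[OF rotating_const ab[OF K order_refl] q[OF K order_refl]])
      fix Z Z1 assume Z: "\<And>\<mu>. Z \<mu> (b K) = 0" "\<And>\<mu>. Z1 \<mu> (b K) = -1"
        "\<And>\<mu> x. x \<in> {a K..b K} \<Longrightarrow> (Z \<mu> has_real_derivative Z1 \<mu> x) (at x within {a K..b K})"
        "\<And>\<mu> x. x \<in> {a K..b K} \<Longrightarrow> (Z1 \<mu> has_real_derivative (q x - \<mu>) * Z \<mu> x) (at x within {a K..b K})"
        "rotating (\<lambda>\<mu>. Z \<mu> (a K)) (\<lambda>\<mu>. Z1 \<mu> (a K))"
        "a K < b K \<or> strictly_rotating (\<lambda>_. 0) (\<lambda>_. -1) \<Longrightarrow>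
          strictly_rotating (\<lambda>\<mu>. Z \<mu> (a K)) (\<lambda>\<mu>. Z1 \<mu> (a K))"
      have "backward_from K q Z Z1" using Z(1-4) by (auto simp: backward_from_def)
      moreover have "a K < b K \<or> a K = b K" using ab[of K] K by force
      ultimately show ?thesis using Z(1,5,6) by (intro exI[of _ Z] exI[of _ Z1]) auto
    qed
  next
    fix n assume n: "1 \<le> n" "n < K" and "?P (Suc n)"
    then obtain Y Y1 where Y: "backward_from (Suc n) q Y Y1"
      and rot: "rotating (\<lambda>\<mu>. Y \<mu> (a (Suc n))) (\<lambda>\<mu>. Y1 \<mu> (a (Suc n)))"
      and lev: "strictly_rotating (\<lambda>\<mu>. Y \<mu> (a (Suc n))) (\<lambda>\<mu>. Y1 \<mu> (a (Suc n))) \<or>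
        (\<forall>l\<in>{Suc n..K}. a l = b l) \<and>
        (Suc n = K \<and> (\<forall>\<mu>. Y \<mu> (a (Suc n)) = 0) \<or> Suc (Suc n) = K \<and> (\<forall>\<mu>. Y \<mu> (a (Suc n)) \<noteq> 0))"
      by blast
    define h where "h = a (Suc n) - b n"
    have h: "h > 0" using ba[of n] n by (simp add: h_def)
    \<comment> \<open>The gap equations solved backward: the second involves \<open>Y\<close> at the
      right end of the gap, so it gives \<open>v\<close> directly, and then the first gives
      \<open>u\<close>.\<close>
    define v where "v \<mu> = Y1 \<mu> (a (Suc n)) - h * (q (b n) - \<mu>) * Y \<mu> (a (Suc n))" for \<mu>
    define u where "u \<mu> = Y \<mu> (a (Suc n)) - h * v \<mu>" for \<mu>
    note gap = rotating_gap[OF rot h v_def u_def]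
    have an: "a n \<le> b n" and qn: "continuous_on {a n..b n} q" using ab q n by auto
    obtain Z Z1 where Z: "\<And>\<mu>. Z \<mu> (b n) = u \<mu>" "\<And>\<mu>. Z1 \<mu> (b n) = v \<mu>"
        "\<And>\<mu> x. x \<in> {a n..b n} \<Longrightarrow> (Z \<mu> has_real_derivative Z1 \<mu> x) (at x within {a n..b n})"
        "\<And>\<mu> x. x \<in> {a n..b n} \<Longrightarrow> (Z1 \<mu> has_real_derivative (q x - \<mu>) * Z \<mu> x) (at x within {a n..b n})"
        "rotating (\<lambda>\<mu>. Z \<mu> (a n)) (\<lambda>\<mu>. Z1 \<mu> (a n))"
        "a n < b n \<or> strictly_rotating u v \<Longrightarrow>
          strictly_rotating (\<lambda>\<mu>. Z \<mu> (a n)) (\<lambda>\<mu>. Z1 \<mu> (a n))"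
      by (rule rotating_block[OF gap(1) an qn]) blast
    have g: "Y \<mu> (a (Suc n)) = Z \<mu> (b n) + (a (Suc n) - b n) * Z1 \<mu> (b n)"
      "Y1 \<mu> (a (Suc n)) = Z1 \<mu> (b n) + (a (Suc n) - b n) * ((q (b n) - \<mu>) * Y \<mu> (a (Suc n)))" for \<mu>
      unfolding Z h_def[symmetric] by (simp_all add: u_def v_def)
    let ?Y = "\<lambda>\<mu> x. if x \<le> b n then Z \<mu> x else Y \<mu> x"
    let ?Y1 = "\<lambda>\<mu> x. if x \<le> b n then Z1 \<mu> x else Y1 \<mu> x"
    have ext: "backward_from n q ?Y ?Y1" by (rule backward_from_extend[OF Y n Z(3,4) g])
    have "strictly_rotating (\<lambda>\<mu>. Z \<mu> (a n)) (\<lambda>\<mu>. Z1 \<mu> (a n)) \<or>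
      (\<forall>l\<in>{n..K}. a l = b l) \<and> Suc n = K \<and> (\<forall>\<mu>. Z \<mu> (a n) \<noteq> 0)"
    proof (cases "a n < b n \<or> strictly_rotating u v")
      case False
      then have single: "a n = b n" and "\<not> (strictly_rotating (\<lambda>\<mu>. Y \<mu> (a (Suc n))) (\<lambda>\<mu>. Y1 \<mu> (a (Suc n))) \<or>
          (\<forall>\<mu>. Y \<mu> (a (Suc n)) \<noteq> 0))"
        using an gap(2) by auto
      with lev have l: "\<forall>l\<in>{Suc n..K}. a l = b l" "Suc n = K" "\<forall>\<mu>. Y \<mu> (a (Suc n)) = 0"
        by auto
      \<comment> \<open>With \<open>Y = 0\<close> at the right end of the gap, the formulas reduce
        to \<open>v = Y1\<close> and \<open>u = - h * Y1\<close>.\<close>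
      have "Y1 \<mu> (a (Suc n)) \<noteq> 0" for \<mu> using rot l(3) by (auto simp: rotating_def)
      then have "Z \<mu> (a n) \<noteq> 0" for \<mu>
        using Z(1)[of \<mu>] single l(3) h by (simp add: u_def v_def)
      moreover have "{n..K} = insert n {Suc n..K}" using n by auto
      ultimately show ?thesis using l(1,2) single by auto
    qed (use Z(6) in blast)
    then show "?P n" using ext Z(5) an by (intro exI[of _ ?Y] exI[of _ ?Y1]) auto
  qed
  then obtain Y Y1 where "backward_from 1 q Y Y1" and
    lev: "strictly_rotating (\<lambda>\<mu>. Y \<mu> (a 1)) (\<lambda>\<mu>. Y1 \<mu> (a 1)) \<or>
     (\<forall>l\<in>{1..K}. a l = b l) \<and> (1 = K \<or> Suc 1 = K)"
    by blast
  moreover have "\<not> ((\<forall>l\<in>{1..K}. a l = b l) \<and> (1 = K \<or> Suc 1 = K))"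
    using large by force
  ultimately show thesis using that by blast
qed

section \<open>Zeros of the backward data correspond to eigenvalues\<close>

lemma tr_singleton: "tr k < l \<Longrightarrow> l \<le> k \<Longrightarrow> l = k \<and> a k = b k"
  by (auto simp: tr_def split: if_splits)

text \<open>Neither the time scale nor its truncation is a single point, so first and second Delta
  derivatives are unique and \<open>delta_deriv\<close> denotes them.\<close>

lemma tr_nondegenerate:
  assumes "(\<exists>l\<in>{1..K}. a l < b l) \<or> 3 \<le> K"
  shows "2 \<le> K \<or> a 1 < b 1" "2 \<le> tr K \<or> a 1 < b 1"
proof -
  show "2 \<le> K \<or> a 1 < b 1" using assms by (cases "K = 1") auto
  show "2 \<le> tr K \<or> a 1 < b 1"
  proof (rule ccontr)
    assume *: "\<not> ?thesis"
    then have "tr K = 1" using tr_bounds(1)[OF K] by simp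
    then have "K \<le> 2" using tr_bounds(3)[of K] by simp
    then obtain l where l: "l \<in> {1..K}" "a l < b l" using assms by auto
    then have "l \<noteq> 1" using * by auto
    then have "tr K < l" using l \<open>tr K = 1\<close> by simp
    then show False using tr_singleton[of K l] l by simp
  qed
qed

text \<open>Truncation removes isolated points only; hence \<open>q\<close> is continuous on every
  segment.\<close>

lemma segment_le_tr_tr:
  assumes "1 \<le> l" "l \<le> K" "a l < b l"
  shows "l \<le> tr (tr K)"
  using tr_singleton[of K l] tr_singleton[of "tr K" l] assms by force

text \<open>The backward solution itself is the eigenfunction. What has to be checked is that its
  blockwise derivatives and gap quotients are Delta derivatives on the successive
  truncations.\<close>

lemma eigenvalueI:
  assumes q: "continuous_on (Ts (tr (tr K))) q"
    and large: "(\<exists>l\<in>{1..K}. a l < b l) \<or> 3 \<le> K"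
    and sol: "backward_from 1 q Y Y1"
    and j: "j = 0 \<and> Y \<mu> (a 1) = 0 \<or> j = 1 \<and> Y1 \<mu> (a 1) = 0"
  shows "complex_of_real \<mu> \<in> eigenvalues (Ts K) q j"
proof -
  define k where "k = tr K"
  define m where "m = tr k"
  have k: "1 \<le> k" "k \<le> K" using tr_bounds[of K] K by (auto simp: k_def)
  have m: "1 \<le> m" "m \<le> k" "m \<le> K" using tr_bounds[of k] k by (auto simp: m_def)
  have T: "trunc (Ts K) = Ts k" "trunc (Ts k) = Ts m" using trunc_Ts K k by (auto simp: k_def m_def)
  note nd = tr_nondegenerate[OF large, folded k_def]
  have dY: "(Y \<mu> has_real_derivative Y1 \<mu> x) (at x within {a l..b l})"
    "(Y1 \<mu> has_real_derivative (q x - \<mu>) * Y \<mu> x) (at x within {a l..b l})"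
    if "1 \<le> l" "l \<le> K" "x \<in> {a l..b l}" for l x
    using sol that unfolding backward_from_def by auto
  have gap: "Y \<mu> (a (Suc l)) - Y \<mu> (b l) = (a (Suc l) - b l) * Y1 \<mu> (b l)"
    "Y1 \<mu> (a (Suc l)) - Y1 \<mu> (b l) = (a (Suc l) - b l) * ((q (b l) - \<mu>) * Y \<mu> (a (Suc l)))"
    if "1 \<le> l" "l < K" for l
    using sol that unfolding backward_from_def by auto
  define y :: "real \<Rightarrow> complex" where "y x = of_real (Y \<mu> x)" for x
  define y1 :: "real \<Rightarrow> complex" where "y1 x = of_real (Y1 \<mu> x)" for x
  \<comment> \<open>\<open>y2\<close> is the second Delta derivative, with the jump in its argument;
    \<open>g\<close> is the right-hand side of the differential equation, continuous on each closed
    block that is left after two truncations. They may differ only at right ends of blocks other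
    than the last one of \<open>Ts k\<close>.\<close>
  define y2 :: "real \<Rightarrow> complex" where "y2 x = of_real ((q x - \<mu>) * Y \<mu> (fjump (Ts k) x))" for x
  define g :: "real \<Rightarrow> complex" where "g x = of_real ((q x - \<mu>) * Y \<mu> x)" for x
  have vy: "(y has_vector_derivative y1 x) (at x within {a l..b l})"
    and vy1: "(y1 has_vector_derivative g x) (at x within {a l..b l})"
    if "1 \<le> l" "l \<le> K" "x \<in> {a l..b l}" for l x
    unfolding y_def[abs_def] y1_def[abs_def] g_def
    by (rule has_vector_derivative_of_real, rule dY[OF that])+
  have cgap: "y (a (Suc l)) - y (b l) = (a (Suc l) - b l) *\<^sub>R y1 (b l)"
    "y1 (a (Suc l)) - y1 (b l) = (a (Suc l) - b l) *\<^sub>R of_real ((q (b l) - \<mu>) * Y \<mu> (a (Suc l)))"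
    if "1 \<le> l" "l < K" for l
    unfolding y_def y1_def scaleR_conv_of_real of_real_diff[symmetric] of_real_mult[symmetric]
    using gap[OF that] by simp_all
  have D1: "has_delta_derivative (Ts K) y (y1 x) x" if "x \<in> Ts k" for x
    using that[unfolded k_def] K order_refl nd(1)
  proof (cases rule: delta_cases)
    case (inner l)
    then show ?thesis using delta_inner_iff[of l K x y "y1 x"] vy[of l x] tr_bounds(2)[of K] by simp
  next
    case (jump l)
    then have bl: "b l \<in> {a l..b l}" using ab by simp
    show ?thesis
      using delta_end_iff[of l K y "y1 x"] jump cgap(1)[of l]
        has_vector_derivative_continuous[OF vy[OF _ _ bl]] by simp
  qed
  then have dd1: "delta_deriv (Ts K) y x = y1 x" if "x \<in> Ts k" for x
    using delta_deriv_eq[OF _ K order_refl nd(1)] that by blast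
  have jumpless: "fjump (Ts k) x = x" if "1 \<le> l" "l \<le> k" "x \<in> {a l..b l}" "x < b l \<or> l = k" for x l
    using fjump_inner[of l k x] fjump_last[of k] that k by force
  have gy: "g x = y2 x" if "1 \<le> l" "l \<le> k" "x \<in> {a l..b l}" "x < b l \<or> l = k" for x l
    using jumpless[OF that] by (simp add: g_def y2_def)
  have D2: "has_delta_derivative (Ts k) (delta_deriv (Ts K) y) (y2 x) x" if "x \<in> Ts m" for x
    using that[unfolded m_def] k nd(2)
  proof (cases rule: delta_cases)
    case (inner l)
    then have l: "l \<le> k" "l \<le> K" using tr_bounds(2)[of k] k by auto
    have "(delta_deriv (Ts K) y has_vector_derivative g x) (at x within {a l..b l})"
      by (rule has_vector_derivative_transform[OF inner(3) _ vy1[OF inner(1) l(2) inner(3)]])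
        (use dd1 in_Ts inner(1) l in blast)
    moreover have "g x = y2 x" by (rule gy[OF inner(1) l(1) inner(3,5)])
    ultimately show ?thesis
      using delta_inner_iff[OF inner(1,2) k(2) inner(3,5), of "delta_deriv (Ts K) y" "y2 x"] by simp
  next
    case (jump l)
    then have bl: "b l \<in> {a l..b l}" "l \<le> K" using ab k by auto
    have e: "delta_deriv (Ts K) y s = y1 s" if "s \<in> {a l..b l}" for s
      using dd1[OF in_Ts[OF that jump(1)]] jump by simp
    have c: "continuous (at (b l) within {a l..b l}) y1"
      by (rule has_vector_derivative_continuous[OF vy1[OF jump(1) bl(2,1)]])
    have "(delta_deriv (Ts K) y \<longlongrightarrow> y1 (b l)) (at (b l) within {a l..b l}) \<longleftrightarrow>
        (y1 \<longlongrightarrow> y1 (b l)) (at (b l) within {a l..b l})"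
      by (rule Lim_cong_within) (simp_all add: e)
    then have "continuous (at (b l) within {a l..b l}) (delta_deriv (Ts K) y)"
      using c e[OF bl(1)] by (simp add: continuous_within)
    moreover have "y2 (b l) = of_real ((q (b l) - \<mu>) * Y \<mu> (a (Suc l)))"
      using fjump_end[of l k] jump k by (simp add: y2_def)
    moreover have "delta_deriv (Ts K) y (a (Suc l)) = y1 (a (Suc l))"
      using dd1 endpoints_in_Ts(1)[of "Suc l" k] jump k by simp
    ultimately show ?thesis
      using delta_end_iff[of l k "delta_deriv (Ts K) y" "y2 (b l)"] jump k cgap(2)[of l] e[OF bl(1)]
      by simp
  qed
  have dd2: "delta_iter (Ts K) 2 y x = y2 x" if "x \<in> Ts m" for x
    using delta_deriv_eq[OF D2[OF that] k nd(2)] by (simp add: numeral_2_eq_2 T)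
  have gc: "continuous_on {a l..b l} g" if "1 \<le> l" "l \<le> m" for l
  proof -
    have "continuous_on {a l..b l} (Y \<mu>)"
      by (rule DERIV_continuous_on, rule dY(1)[of l]) (use that m in auto)
    moreover have "continuous_on {a l..b l} q"
      by (rule continuous_on_subset[OF q]) (use that in_Ts in \<open>auto simp: m_def k_def\<close>)
    ultimately show ?thesis unfolding g_def by (intro continuous_intros)
  qed
  have rd: "rd_continuous_on (Ts k) (Ts m) y2"
    unfolding rd_continuous_on_def
  proof (intro ballI conjI impI)
    fix t assume t: "t \<in> Ts m" and tj: "fjump (Ts k) t = t"
    show "continuous (at t within Ts m) y2"
      using t[unfolded m_def] k nd(2)
    proof (cases rule: delta_cases)
      case (inner l)
      then have l: "l \<le> m" "l \<le> k" using m by (auto simp: m_def)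
      have "(g \<longlongrightarrow> g t) (at t within {a l..b l})"
        using gc[OF inner(1) l(1)] inner(3) by (simp add: continuous_on_def)
      moreover have "\<forall>\<^sub>F s in at t within {a l..b l}. g s = y2 s"
      proof (cases "l = k")
        case True
        then show ?thesis
          using gy[OF inner(1) l(2)] by (auto simp: eventually_at intro!: exI[of _ 1])
      next
        case False
        then have "t < b l" using inner(5) by simp
        moreover have "s < b l" if "dist s t < b l - t" for s
          using that by (auto simp: dist_real_def abs_less_iff)
        ultimately show ?thesis
          using gy[OF inner(1) l(2)] unfolding eventually_at
          by (intro exI[of _ "b l - t"]) auto
      qed
      ultimately have "(y2 \<longlongrightarrow> g t) (at t within {a l..b l})"
        by (rule Lim_transform_eventually)
      moreover have "g t = y2 t" using tj by (simp add: g_def y2_def)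
      ultimately show ?thesis
        using at_within_Ts[of l m t] inner(1,3) l(1) m(3) by (simp add: continuous_within)
    next
      case (jump l)
      then show ?thesis using fjump_end[of l k] ba[of l] tj k by auto
    qed
  next
    \<comment> \<open>\<open>y2\<close> may jump at \<open>t\<close>, but just to its left it agrees
      with \<open>g\<close>, so \<open>g t\<close> is the left limit. The start of a block is
      left-isolated, except for the minimum, which has no points to its left.\<close>
    fix t assume t: "t \<in> Ts m" and li: "\<not> left_isolated (Ts k) t"
    obtain l where l: "1 \<le> l" "l \<le> m" "t \<in> {a l..b l}" using t by (rule Ts_cases)
    show "\<exists>L. (y2 \<longlongrightarrow> L) (at t within Ts m \<inter> {..<t})"
    proof (cases "t = a l")
      case True
      have "l = 1" using left_isolated_start[of l k] li l m k True by fastforce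
      then have "Ts m \<inter> {..<t} = {}" using Ts_bounds(1)[of _ m] True m by fastforce
      then show ?thesis by simp
    next
      case False
      then have tl: "a l < t" "t \<le> b l" using l by auto
      have "(g \<longlongrightarrow> g t) (at t within {a l..b l})"
        using gc[OF l(1,2)] l(3) by (simp add: continuous_on_def)
      then have "(g \<longlongrightarrow> g t) (at t within Ts m)"
        using at_within_Ts[of l m t] l m(3) by simp
      then have "(g \<longlongrightarrow> g t) (at t within Ts m \<inter> {..<t})"
        by (rule tendsto_within_subset) simp
      moreover have "\<forall>\<^sub>F s in at t within Ts m \<inter> {..<t}. g s = y2 s"
        unfolding eventually_at
      proof (intro exI[of _ "t - a l"] conjI ballI impI)
        fix s assume s: "s \<in> Ts m \<inter> {..<t}" "s \<noteq> t \<and> dist s t < t - a l"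
        then have "a l < s" by (auto simp: dist_real_def abs_less_iff)
        then show "g s = y2 s" using gy[OF l(1), of s] s(1) l(2) m(2) tl by simp
      qed (use tl in simp)
      ultimately have "(y2 \<longlongrightarrow> g t) (at t within Ts m \<inter> {..<t})"
        by (rule Lim_transform_eventually)
      then show ?thesis by blast
    qed
  qed
  have "is_solution (Ts K) q (complex_of_real \<mu>) y"
    unfolding is_solution_def C2_def T
  proof (intro conjI ballI)
    show "delta_differentiable (Ts K) y x" if "x \<in> Ts k" for x
      using D1[OF that] by (auto simp: delta_differentiable_def)
    show "delta_differentiable (Ts k) (delta_deriv (Ts K) y) x" if "x \<in> Ts m" for x
      using D2[OF that] by (auto simp: delta_differentiable_def)
    show "rd_continuous_on (Ts k) (Ts m) (delta_iter (Ts K) 2 y)"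
      using rd rd_continuous_on_cong[of "Ts m" "delta_iter (Ts K) 2 y" y2, OF dd2] by simp
    show "- delta_iter (Ts K) 2 y x + of_real (q x) * y (fjump (Ts k) x) = of_real \<mu> * y (fjump (Ts k) x)"
      if "x \<in> Ts m" for x
      using dd2[OF that] by (simp add: y2_def y_def algebra_simps)
  qed
  \<comment> \<open>If \<open>y\<close> vanished, \<open>Y1\<close> would be 0 at
    \<open>b K\<close>: by differentiation on a final segment, by the two gap equations at a final
    isolated point.\<close>
  moreover have "\<exists>x\<in>Ts K. y x \<noteq> 0"
  proof (rule ccontr)
    assume "\<not> ?thesis"
    then have zero: "Y \<mu> x = 0" if "x \<in> Ts K" for x using that by (auto simp: y_def)
    have Y1: "Y1 \<mu> (b K) = -1" using sol by (simp add: backward_from_def)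
    show False
    proof (cases "a K < b K")
      case True
      have bK: "b K \<in> {a K..b K}" using True by simp
      have "(Y \<mu> has_real_derivative 0) (at (b K) within {a K..b K})"
        by (rule has_field_derivative_transform_within[of "\<lambda>_. 0", OF _ zero_less_one bK])
          (use zero in_Ts[of _ K K] K in auto)
      then have "Y1 \<mu> (b K) = 0"
        using dY(1)[OF K order_refl bK] vector_derivative_unique_within_closed_interval[of "a K" "b K" "b K" "Y \<mu>"] True
        by (auto simp: has_real_derivative_iff_has_vector_derivative)
      then show False using Y1 by simp
    next
      case False
      then have eq: "a K = b K" using ab[OF K] by simp
      then have "2 \<le> K" using nd(1) K by (cases "K = 1") auto
      then obtain n where n: "K = Suc n" "1 \<le> n" by (cases K) auto
      have "Y \<mu> (a K) - Y \<mu> (b n) = (a K - b n) * Y1 \<mu> (b n)"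
        "Y1 \<mu> (a K) - Y1 \<mu> (b n) = (a K - b n) * ((q (b n) - \<mu>) * Y \<mu> (a K))"
        using gap[of n] n by auto
      moreover have "Y \<mu> (a K) = 0" "Y \<mu> (b n) = 0"
        using zero endpoints_in_Ts[of K K] endpoints_in_Ts[of n K] n K by auto
      ultimately have "(a K - b n) * Y1 \<mu> (a K) = 0" by simp
      then show False using Y1 eq ba[of n] n by simp
    qed
  qed
  moreover have "delta_iter (Ts K) j y (Inf (Ts K)) = 0"
    using j dd1[OF endpoints_in_Ts(1)[of 1 k]] Inf_Ts[OF K order_refl] k K
    by (auto simp: y_def y1_def)
  moreover have "y (Sup (Ts K)) = 0"
    using Sup_Ts[OF K order_refl] sol by (simp add: y_def backward_from_def)
  ultimately show ?thesis unfolding eigenvalues_def by blast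
qed

text \<open>The Wronskian of the eigenfunction with the backward solution vanishes at the right and
  is invariant along blocks and across gaps. At the left end the two pairs of data are then
  proportional, so the backward solution inherits the boundary condition there.\<close>

lemma eigenvalueD:
  assumes q: "continuous_on (Ts (tr (tr K))) q"
    and large: "(\<exists>l\<in>{1..K}. a l < b l) \<or> 3 \<le> K"
    and sol: "backward_from 1 q Y Y1"
    and ev: "complex_of_real \<mu> \<in> eigenvalues (Ts K) q j"
  shows "j = 0 \<Longrightarrow> Y \<mu> (a 1) = 0" "j = 1 \<Longrightarrow> Y1 \<mu> (a 1) = 0"
proof -
  define k where "k = tr K"
  define m where "m = tr k"
  have k: "1 \<le> k" "k \<le> K" "K \<le> Suc k" using tr_bounds[of K] K by (auto simp: k_def)
  have m: "1 \<le> m" "m \<le> k" "m \<le> K" "k \<le> Suc m" using tr_bounds[of k] k by (auto simp: m_def)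
  have T: "trunc (Ts K) = Ts k" "trunc (Ts k) = Ts m" using trunc_Ts K k by (auto simp: k_def m_def)
  note nd = tr_nondegenerate[OF large, folded k_def]
  have dY: "(Y \<mu> has_real_derivative Y1 \<mu> x) (at x within {a l..b l})"
    "(Y1 \<mu> has_real_derivative (q x - \<mu>) * Y \<mu> x) (at x within {a l..b l})"
    if "1 \<le> l" "l \<le> K" "x \<in> {a l..b l}" for l x
    using sol that unfolding backward_from_def by auto
  have gap: "Y \<mu> (a (Suc l)) = Y \<mu> (b l) + (a (Suc l) - b l) * Y1 \<mu> (b l)"
    "Y1 \<mu> (a (Suc l)) = Y1 \<mu> (b l) + (a (Suc l) - b l) * ((q (b l) - \<mu>) * Y \<mu> (a (Suc l)))"
    if "1 \<le> l" "l < K" for l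
    using sol that unfolding backward_from_def by auto
  have bK: "Y \<mu> (b K) = 0" using sol by (simp add: backward_from_def)
  from ev obtain y where y: "is_solution (Ts K) q (complex_of_real \<mu>) y" "\<exists>x\<in>Ts K. y x \<noteq> 0"
    "delta_iter (Ts K) j y (a 1) = 0" "y (b K) = 0"
    unfolding eigenvalues_def using Sup_Ts[OF K order_refl] Inf_Ts[OF K order_refl] by auto
  define y1 where "y1 = delta_deriv (Ts K) y"
  have D1: "has_delta_derivative (Ts K) y (y1 x) x" if "x \<in> Ts k" for x
    using y(1) that delta_differentiable_deriv[OF _ K order_refl nd(1)]
    unfolding is_solution_def C2_def T y1_def by blast
  have D2: "has_delta_derivative (Ts k) y1 ((q x - \<mu>) *\<^sub>R y (fjump (Ts k) x)) x" if x: "x \<in> Ts m" for x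
  proof -
    have "has_delta_derivative (Ts k) y1 (delta_deriv (Ts k) y1 x) x"
      using y(1) x delta_differentiable_deriv[OF _ k(1,2) nd(2)]
      unfolding is_solution_def C2_def T y1_def by blast
    moreover have "- delta_deriv (Ts k) y1 x + of_real (q x) * y (fjump (Ts k) x) = of_real \<mu> * y (fjump (Ts k) x)"
      using y(1) x unfolding is_solution_def T y1_def by (simp add: numeral_2_eq_2 T)
    then have "delta_deriv (Ts k) y1 x = (q x - \<mu>) *\<^sub>R y (fjump (Ts k) x)"
      by (simp add: scaleR_conv_of_real algebra_simps add_eq_0_iff2)
    ultimately show ?thesis by simp
  qed
  note seg = segment_le_tr_tr[folded k_def, folded m_def]
  have cont: "continuous_on {a l..b l} y" "continuous_on {a l..b l} y1"
    if l: "1 \<le> l" "l \<le> K" "a l < b l" for l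
    using delta_derivative_continuous[OF D1 _ _ order_refl, of _ l]
      delta_derivative_continuous[OF D2 _ _ k(2), of _ l] in_Ts[of _ l k] in_Ts[of _ l m] seg[OF l] l(1) m
    unfolding continuous_on_eq_continuous_within k_def[symmetric] m_def[symmetric] by auto
  have ode: "(y has_vector_derivative y1 x) (at x)" "(y1 has_vector_derivative (q x - \<mu>) *\<^sub>R y x) (at x)"
    if l: "1 \<le> l" "l \<le> K" and x: "x \<in> {a l<..<b l}" for l x
  proof -
    have lm: "l \<le> m" "l \<le> k" using seg[of l] l x m by auto
    have x': "x \<in> {a l..b l}" "a l < x" "x < b l" using x by auto
    have "x \<in> Ts k" "x \<in> Ts m" using in_Ts[OF x'(1) l(1)] lm by auto
    moreover have "fjump (Ts k) x = x" using fjump_inner[of l k x] l lm x' k by simp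
    ultimately show "(y has_vector_derivative y1 x) (at x)" "(y1 has_vector_derivative (q x - \<mu>) *\<^sub>R y x) (at x)"
      using D1[of x] D2[of x] delta_inner_iff[of l K x y] delta_inner_iff[of l k x y1] l lm x' k
      by (auto simp: k_def[symmetric] m_def[symmetric] at_within_Icc_at)
  qed
  have cgap: "y (a (Suc l)) = y (b l) + (a (Suc l) - b l) *\<^sub>R y1 (b l)" if "1 \<le> l" "l < K" for l
    using D1[of "b l"] delta_end_iff[of l K y] endpoints_in_Ts(2)[of l k] that k
    by (simp add: algebra_simps diff_eq_eq)
  have cgap1: "y1 (a (Suc l)) = y1 (b l) + (a (Suc l) - b l) *\<^sub>R ((q (b l) - \<mu>) *\<^sub>R y (a (Suc l)))"
    if "1 \<le> l" "l < k" for l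
    using D2[of "b l"] delta_end_iff[of l k y1] endpoints_in_Ts(2)[of l m] fjump_end[of l k] that k m
    by (simp add: algebra_simps diff_eq_eq)
  define W where "W x = Y1 \<mu> x *\<^sub>R y x - Y \<mu> x *\<^sub>R y1 x" for x
  have Wblock: "W (a l) = W (b l)" if l: "1 \<le> l" "l \<le> K" for l
  proof (cases "a l = b l")
    case False
    then have lt: "a l < b l" using ab[OF l] by simp
    show ?thesis unfolding W_def
      by (rule wronskian_constant[OF cont[OF l lt] ode[OF l] dY[OF l]]) (use lt in auto)
  qed simp
  \<comment> \<open>\<open>y1\<close> is meaningless at an isolated maximum. Since \<open>y\<close>
    and \<open>Y \<mu>\<close> both vanish there, at \<open>b k\<close> they are the same multiple
    of \<open>y1\<close> and \<open>Y1 \<mu>\<close>, and this makes the Wronskian zero already at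
    that point.\<close>
  have Wend: "W (b k) = 0"
  proof (cases "k = K")
    case True
    then show ?thesis using y(4) bK by (simp add: W_def)
  next
    case False
    then have K': "K = Suc k" "a K = b K"
      using k tr_singleton[of K K] by (auto simp: k_def)
    then have "Y \<mu> (b k) = - ((a K - b k) * Y1 \<mu> (b k))" "y (b k) = - ((a K - b k) *\<^sub>R y1 (b k))"
      using gap(1)[of k] cgap[of k] bK y(4) k by (auto simp: add_eq_0_iff2)
    then show ?thesis by (simp add: W_def mult.commute)
  qed
  have "W (b 1) = 0"
  proof (rule inc_induct[where i = 1 and j = k and P = "\<lambda>l. W (b l) = 0"])
    fix l assume l: "1 \<le> l" "l < k" and "W (b (Suc l)) = 0"
    then have 0: "W (a (Suc l)) = 0" using Wblock[of "Suc l"] k by simp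
    \<comment> \<open>Both pairs cross the gap by the same two shears, which have determinant
      1.\<close>
    have step: "Z1 *\<^sub>R w - Z *\<^sub>R w1 = Z1' *\<^sub>R w' - Z' *\<^sub>R w1'"
      if "Z' = Z + h * Z1" "Z1' = Z1 + h * (r * Z')" "w' = w + h *\<^sub>R w1" "w1' = w1 + h *\<^sub>R (r *\<^sub>R w')"
      for Z Z1 Z' Z1' h r :: real and w w1 w' w1' :: complex
      by (simp add: that algebra_simps)
    have "W (b l) = W (a (Suc l))"
      unfolding W_def by (rule step[OF gap cgap cgap1]) (use l k in auto)
    then show "W (b l) = 0" using 0 by simp
  qed (use k Wend in auto)
  then have W: "Y1 \<mu> (a 1) *\<^sub>R y (a 1) = Y \<mu> (a 1) *\<^sub>R y1 (a 1)"
    using Wblock[of 1] K by (simp add: W_def)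
  \<comment> \<open>Zero data at the left end would propagate to the right through blocks and gaps.
    The derivative is followed only while \<open>l \<le> k\<close>; a further isolated point is
    reached through \<open>cgap\<close>, which needs no derivative there.\<close>
  have nz: "y (a 1) \<noteq> 0 \<or> y1 (a 1) \<noteq> 0"
  proof (rule ccontr)
    assume start: "\<not> ?thesis"
    have blockzero: "y x = 0 \<and> (l \<le> k \<longrightarrow> y1 x = 0)"
      if l: "1 \<le> l" "l \<le> K" and z: "y (a l) = 0" "l \<le> k \<Longrightarrow> y1 (a l) = 0" and x: "x \<in> {a l..b l}" for l x
    proof (cases "a l = b l")
      case True
      then show ?thesis using z x by auto
    next
      case False
      then have lt: "a l < b l" using ab[OF l] by simp
      have qc: "continuous_on {a l..b l} q"
        by (rule continuous_on_subset[OF q])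
          (use in_Ts[of _ l m] seg[OF l lt] l in \<open>auto simp: k_def m_def\<close>)
      have "a l \<in> {a l..b l}" "l \<le> k" using lt seg[OF l lt] m by auto
      then show ?thesis
        using linear_ivp_unique[OF qc cont[OF l lt] ode[OF l], of "a l" x] z x by auto
    qed
    have "y (a l) = 0 \<and> (l \<le> k \<longrightarrow> y1 (a l) = 0)" if "1 \<le> l" "l \<le> K" for l
      using that
    proof (induction l rule: dec_induct)
      case base
      then show ?case using start by simp
    next
      case (step l)
      have "b l \<in> {a l..b l}" "l \<le> k" using ab[of l] step k by auto
      then have "y (b l) = 0" "y1 (b l) = 0" using blockzero[of l "b l"] step by auto
      then show ?case using cgap[of l] cgap1[of l] step by auto
    qed
    then have "y x = 0" if "x \<in> Ts K" for x
      using that blockzero by (metis Ts_cases)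
    then show False using y(2) by blast
  qed
  \<comment> \<open>In \<open>W\<close> the boundary condition removes one side, and on the other
    side the remaining datum of \<open>y\<close> is nonzero by \<open>nz\<close>.\<close>
  show "Y \<mu> (a 1) = 0" if "j = 0" using W nz y(3) that by simp
  show "Y1 \<mu> (a 1) = 0" if "j = 1" using W nz y(3) that by (simp add: y1_def)
qed

end

section \<open>Alternation\<close>

text \<open>Any term of \<open>r\<close> found above \<open>s n\<close> has index greater than
  \<open>n\<close> because \<open>r n < s n\<close>, so \<open>r (Suc n)\<close> is no larger;
  likewise with the roles exchanged. Only the start of the count needs \<open>r_below\<close>. All
  terms found in between are indexed by the same set \<open>I\<close>.\<close>

lemma interlacing_numbering:
  fixes r s :: "nat \<Rightarrow> real"
  assumes I: "\<And>n. n \<in> I \<Longrightarrow> 1 \<le> n" "\<And>n. Suc n \<in> I \<Longrightarrow> 1 \<le> n \<Longrightarrow> n \<in> I"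
    and mono: "strict_mono_on I r" "strict_mono_on I s"
    and r_below: "\<And>n. n \<in> I \<Longrightarrow> \<exists>m\<in>I. r m < s n"
    and r_between: "\<And>n. n \<in> I \<Longrightarrow> Suc n \<in> I \<Longrightarrow> \<exists>m\<in>I. s n < r m \<and> r m < s (Suc n)"
    and s_between: "\<And>n. n \<in> I \<Longrightarrow> Suc n \<in> I \<Longrightarrow> \<exists>m\<in>I. r n < s m \<and> s m < r (Suc n)"
  shows "n \<in> I \<Longrightarrow> r n < s n" and "Suc n \<in> I \<Longrightarrow> 1 \<le> n \<Longrightarrow> s n < r (Suc n)"
proof -
  have le: "r i \<le> r j" "s i \<le> s j" if "i \<in> I" "j \<in> I" "i \<le> j" for i j
    using mono that by (auto simp: strict_mono_on_def le_less)
  have less: "i < j" if "i \<in> I" "j \<in> I" "r i < r j \<or> s i < s j" for i j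
    using le[of j i] that by linarith
  have "n \<in> I \<longrightarrow> r n < s n" if "1 \<le> n" for n
    using that
  proof (induction n rule: dec_induct)
    case base
    show ?case
    proof
      assume "1 \<in> I"
      then obtain m where m: "m \<in> I" "r m < s 1" using r_below by blast
      show "r 1 < s 1" using le(1)[OF \<open>1 \<in> I\<close> m(1)] I(1)[OF m(1)] m(2) by linarith
    qed
  next
    case (step n)
    show ?case
    proof
      assume S: "Suc n \<in> I"
      then have n: "n \<in> I" using I(2) step by blast
      obtain m where m: "m \<in> I" "s n < r m" "r m < s (Suc n)" using r_between[OF n S] by blast
      have "n < m" using less[OF n m(1)] step.IH n m(2) by force
      then show "r (Suc n) < s (Suc n)" using le(1)[OF S m(1)] m(3) by simp
    qed
  qed
  then show "n \<in> I \<Longrightarrow> r n < s n" for n using I(1) by blast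
  have "Suc n \<in> I \<longrightarrow> s n < r (Suc n)" if "1 \<le> n" for n
    using that
  proof (induction n rule: dec_induct)
    case base
    show ?case
    proof
      assume S: "Suc 1 \<in> I"
      then have 1: "1 \<in> I" using I(2) by blast
      obtain m where m: "m \<in> I" "s m < r (Suc 1)" using s_between[OF 1 S] by blast
      show "s 1 < r (Suc 1)" using le(2)[OF 1 m(1)] I(1)[OF m(1)] m(2) by linarith
    qed
  next
    case (step n)
    show ?case
    proof
      assume S: "Suc (Suc n) \<in> I"
      then have S': "Suc n \<in> I" using I(2) by simp
      then have n: "n \<in> I" using I(2) step by blast
      obtain m where m: "m \<in> I" "r (Suc n) < s m" "s m < r (Suc (Suc n))" using s_between[OF S' S] by blast
      have "n < m" using less[OF n m(1)] step.IH S' m(2) by force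
      then show "s (Suc n) < r (Suc (Suc n))" using le(2)[OF S' m(1)] m(3) by simp
    qed
  qed
  then show "Suc n \<in> I \<Longrightarrow> 1 \<le> n \<Longrightarrow> s n < r (Suc n)" for n by blast
qed

theorem theorem1:
  fixes N M :: nat
    and a b :: "nat \<Rightarrow> real"
    and T :: "real set"
    and q :: "real \<Rightarrow> real"
    and lam :: "nat \<Rightarrow> nat \<Rightarrow> real"
  assumes "N > 0 \<or> M \<ge> 3"
    and "\<forall>l\<in>{1..N + M}. a l \<le> b l"
    and "\<forall>l\<in>{2..N + M}. b (l - 1) < a l"
    and "card {l \<in> {1..N + M}. a l < b l} = N"
    and "card {l \<in> {1..N + M}. a l = b l} = M"
    and "T = (\<Union>l\<in>{1..N + M}. {a l..b l})"
    and "continuous_on (trunc (trunc T)) q"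
    and "\<forall>j\<in>{0, 1}. increasing_numbering (Theta N M) (eigenvalues T q j) (\<lambda>n. lam n j)"
  shows "\<forall>n. 1 \<le> n \<and> enat n \<le> Theta N M \<longrightarrow>
           lam n 1 < lam n 0 \<and>
           ereal (lam n 0) <
             (if N = 0 \<and> n + 1 = M - 1 then \<infinity> else ereal (lam (n + 1) 1))"
proof -
  define K where "K = N + M"
  interpret block_scale a b K
  proof
    show "1 \<le> K" using assms(1) by (auto simp: K_def)
    show "a l \<le> b l" if "1 \<le> l" "l \<le> K" for l using assms(2) that by (auto simp: K_def)
    show "b l < a (Suc l)" if "1 \<le> l" "l < K" for l
      using assms(3)[rule_format, of "Suc l"] that by (auto simp: K_def)
  qed
  have T: "T = Ts K" using assms(6) by (simp add: Ts_def K_def)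
  have qT: "continuous_on (Ts (tr (tr K))) q"
    using assms(7) tr_bounds[of K] K by (simp add: T trunc_Ts)
  have large: "(\<exists>l\<in>{1..K}. a l < b l) \<or> 3 \<le> K"
  proof (cases "N > 0")
    case True
    then have "{l \<in> {1..K}. a l < b l} \<noteq> {}" using assms(4) unfolding K_def by (metis card.empty less_irrefl)
    then show ?thesis by blast
  qed (use assms(1) in \<open>auto simp: K_def\<close>)
  \<comment> \<open>Isolated points may lie outside the domain where \<open>q\<close> is given as
    continuous, but on a single point continuity is automatic.\<close>
  have "continuous_on {a l..b l} q" if l: "1 \<le> l" "l \<le> K" for l
  proof (cases "a l < b l")
    case True
    show ?thesis
      by (rule continuous_on_subset[OF qT]) (use segment_le_tr_tr[OF l True] l in_Ts in blast)
  next
    case False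
    then show ?thesis using ab[OF l] by (cases "a l = b l") (auto simp: continuous_on_sing)
  qed
  then obtain Y Y1 where Y: "backward_from 1 q Y Y1"
    and rot: "strictly_rotating (\<lambda>\<mu>. Y \<mu> (a 1)) (\<lambda>\<mu>. Y1 \<mu> (a 1))"
    by (rule backward_solution_exists[OF _ large])
  define u v where "u \<mu> = Y \<mu> (a 1)" and "v \<mu> = Y1 \<mu> (a 1)" for \<mu>
  have phase: "increasing_phase u v" and low: "\<forall>\<^sub>F \<mu> in at_bot. u \<mu> * v \<mu> < 0"
    using rot strictly_rotating_increasing_phase[OF rot]
    by (auto simp: strictly_rotating_def u_def[abs_def] v_def[abs_def])
  define I where "I = {n. 1 \<le> n \<and> enat n \<le> Theta N M}"
  have num: "strict_mono_on I (\<lambda>n. lam n j)" "eigenvalues T q j = (\<lambda>n. complex_of_real (lam n j)) ` I"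
    if "j = 0 \<or> j = 1" for j
    using assms(8) that by (auto simp: increasing_numbering_def I_def)
  \<comment> \<open>Real parameters suffice: the numbering presents the spectrum as the image of
    reals under the injective \<open>complex_of_real\<close>.\<close>
  have zero_u: "u \<mu> = 0 \<longleftrightarrow> (\<exists>n\<in>I. \<mu> = lam n 0)" for \<mu>
  proof -
    have "u \<mu> = 0 \<longleftrightarrow> complex_of_real \<mu> \<in> eigenvalues T q 0"
      using eigenvalueI[OF qT large Y, of 0 \<mu>] eigenvalueD(1)[OF qT large Y, of \<mu> 0] by (auto simp: u_def T)
    then show ?thesis using num(2)[of 0] by auto
  qed
  have zero_v: "v \<mu> = 0 \<longleftrightarrow> (\<exists>n\<in>I. \<mu> = lam n 1)" for \<mu>
  proof -
    have "v \<mu> = 0 \<longleftrightarrow> complex_of_real \<mu> \<in> eigenvalues T q 1"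
      using eigenvalueI[OF qT large Y, of 1 \<mu>] eigenvalueD(2)[OF qT large Y, of \<mu> 1] by (auto simp: v_def T)
    then show ?thesis using num(2)[of 1] by auto
  qed
  have I: "1 \<le> n" "Suc m \<in> I \<Longrightarrow> 1 \<le> m \<Longrightarrow> m \<in> I" if "n \<in> I" for n m
    using that order_trans[of "enat m" "enat (Suc m)" "Theta N M"] by (auto simp: I_def)
  have below: "\<exists>m\<in>I. lam m 1 < lam n 0" if "n \<in> I" for n
  proof -
    have "u (lam n 0) = 0" using zero_u that by blast
    from increasing_phase_zero_below[OF phase low this] show ?thesis by (auto simp: zero_v)
  qed
  have between1: "\<exists>m\<in>I. lam n 0 < lam m 1 \<and> lam m 1 < lam (Suc n) 0" if "n \<in> I" "Suc n \<in> I" for n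
  proof -
    have "lam n 0 < lam (Suc n) 0" using num(1)[of 0] that by (simp add: strict_mono_on_def)
    moreover have "u (lam n 0) = 0" "u (lam (Suc n) 0) = 0" using zero_u that by blast+
    ultimately have "\<exists>z. lam n 0 < z \<and> z < lam (Suc n) 0 \<and> - v z = 0"
      by (rule increasing_phase_zero_between[OF increasing_phase_swap[OF phase]])
    then show ?thesis by (auto simp: zero_v)
  qed
  have between0: "\<exists>m\<in>I. lam n 1 < lam m 0 \<and> lam m 0 < lam (Suc n) 1" if "n \<in> I" "Suc n \<in> I" for n
  proof -
    have "lam n 1 < lam (Suc n) 1" using num(1)[of 1] that by (simp add: strict_mono_on_def)
    moreover have "v (lam n 1) = 0" "v (lam (Suc n) 1) = 0" using zero_v that by blast+
    ultimately have "\<exists>z. lam n 1 < z \<and> z < lam (Suc n) 1 \<and> u z = 0"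
      by (rule increasing_phase_zero_between[OF phase])
    then show ?thesis by (auto simp: zero_u)
  qed
  have first: "lam n 1 < lam n 0" if "n \<in> I" for n
    by (rule interlacing_numbering(1)[of I "\<lambda>n. lam n 1" "\<lambda>n. lam n 0"])
      (use I num(1) below between0 between1 that in blast)+
  have second: "lam n 0 < lam (Suc n) 1" if "Suc n \<in> I" "1 \<le> n" for n
    by (rule interlacing_numbering(2)[of I "\<lambda>n. lam n 1" "\<lambda>n. lam n 0"])
      (use I num(1) below between0 between1 that in blast)+
  show ?thesis
  proof (intro allI impI conjI)
    fix n assume n: "1 \<le> n \<and> enat n \<le> Theta N M"
    then show "lam n 1 < lam n 0" using first by (simp add: I_def)
    show "ereal (lam n 0) < (if N = 0 \<and> n + 1 = M - 1 then \<infinity> else ereal (lam (n + 1) 1))"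
    proof (cases "N = 0 \<and> n + 1 = M - 1")
      case False
      \<comment> \<open>For \<open>N = 0\<close> the excluded case is \<open>n = M - 2\<close>, so
        \<open>n\<close> is strictly below the last index.\<close>
      then have "enat (Suc n) \<le> Theta N M" using n by (auto simp: Theta_def)
      then show ?thesis using second[of n] n False by (simp add: I_def)
    qed simp
  qed
qed

end
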